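(* For $n=3$, $$\mathcal P_{3,-1}=D_{123}^3\,\mathcal A_3 .$$ Thus $\mathcal P_{3,-1}$ is a free $\mathcal A_3$-module of rank $1$, while the space $\mathcal Q_3=\mathcal P_{3,-1}/\mathcal A_3^+\mathcal P_{3,-1}$ is one-dimensional over $\mathbb R$ and concentrated in $C$-degree $0$.
   Context: Let $R_3=\mathbb R[x_i,y_i,p_i,q_i\mid i=1,2,3]$. For $T=\begin{pmatrix} a_1 & a_2 & a_3 \\ b_1 & b_2 & b_3 \\ c_1 & c_2 & c_3 \end{pmatrix}\in GL(3,\mathbb R)$ and $g=[T]\in PGL(3,\mathbb R)$, put $s_i=c_1x_i+c_2y_i+c_3$. The element $g$ acts (where all $s_i\ne0$) diagonally on $z=(x_i,y_i,p_i,q_i)_{i=1}^3$ by $(x_i,y_i)\mapsto\left(\frac{a_1x_i+a_2y_i+a_3}{s_i},\frac{b_1x_i+b_2y_i+b_3}{s_i}\right)$, with $(p_i,q_i)$ transforming as the first-order partial derivatives of a scalar function at $(x_i,y_i)$. Equivalently, with $A_i=(x_i,y_i,1)^T$ (column) and $\ell_i=(p_i,q_i,-p_ix_i-q_iy_i)$ (row), the action is $A_i\mapsto TA_i/s_i$, $\ell_i\mapsto s_i\ell_iT^{-1}$. Put $J(g)=\frac{(\det T)^3}{(s_1s_2s_3)^3}$. $\mathcal A_3$ (resp. $\mathcal P_{3,-1}$) is the set of all $F\in R_3$ with $F(g\cdot z)=F(z)$ (resp. $F(g\cdot z)=J(g)^{-1}F(z)$) for all $g\in PGL(3,\mathbb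 R)$ and $z$ for which the action is defined; $\mathcal P_{3,-1}$ is an $\mathcal A_3$-module. $D_{123}=\det(\ell_1,\ell_2,\ell_3)$ and $C_{ij}=\ell_iA_j$. $C$-grading: $\mathcal A_3$ is spanned by those monomials in the $C_{ij}$ ($i\ne j$) that lie in $\mathcal A_3$, and $\mathcal P_{3,-1}$ by those monomials in $D_{123}$ and the $C_{ij}$ that lie in $\mathcal P_{3,-1}$ (each has exactly $3$ factors $D_{123}$); the $C$-degree is the number of factors $C_{ij}$ (equivalently, total degree in the $p_i,q_i$ is $k$ on $(\mathcal A_3)_k$, and $9+k$ on $\mathcal P_{3,-1}^{(k)}$). $\mathcal A_3^+=\bigoplus_{k>0}(\mathcal A_3)_k$, and $\mathcal Q_3$ carries the induced grading. *)

theory Defs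
  imports "HOL-Analysis.Analysis" "HOL-Library.Poly_Mapping" "HOL-Algebra.Module" "HOL-Algebra.QuotRing"
begin

section \<open>Polynomials in the coordinates of three points with covectors\<close>

text \<open>The index \<open>i\<close> ranges over the type \<open>3\<close>, whose elements are \<open>1\<close>, \<open>2\<close>, \<open>3\<close>.\<close>

datatype var = VX 3 | VY 3 | VP 3 | VQ 3

type_synonym rpoly = "(var \<Rightarrow>\<^sub>0 nat) \<Rightarrow>\<^sub>0 real"

definition Var :: "var \<Rightarrow> rpoly" where
  "Var v = Poly_Mapping.single (Poly_Mapping.single v 1) 1"

definition Const :: "real \<Rightarrow> rpoly" where
  "Const c = Poly_Mapping.single 0 c"

definition eval_poly :: "rpoly \<Rightarrow> (var \<Rightarrow> real) \<Rightarrow> real" where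
  "eval_poly F z =
     (\<Sum>m\<in>Poly_Mapping.keys F. Poly_Mapping.lookup F m *
        (\<Prod>v\<in>Poly_Mapping.keys m. z v ^ Poly_Mapping.lookup m v))"

interpretation rpoly: vector_space "\<lambda>c F. Const c * F"
proof unfold_locales
  fix F :: rpoly
  show "Const 1 * F = F" by (simp add: Const_def)
qed (simp_all add: Const_def distrib_left distrib_right single_add mult_single flip: mult.assoc)


section \<open>The projective action\<close>

text \<open>\<open>pt z i\<close> is the column \<open>A\<^sub>i\<close> and \<open>ell z i\<close> the row \<open>\<ell>\<^sub>i\<close>. Both are used with real
  coordinates \<open>z\<close> and, taking \<open>z = Var\<close>, with the indeterminates.\<close>

definition pt :: "(var \<Rightarrow> 'a::comm_ring_1) \<Rightarrow> 3 \<Rightarrow> 'a^3" where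
  "pt z i = vector [z (VX i), z (VY i), 1]"

definition ell :: "(var \<Rightarrow> 'a::comm_ring_1) \<Rightarrow> 3 \<Rightarrow> 'a^3" where
  "ell z i = vector [z (VP i), z (VQ i), - z (VP i) * z (VX i) - z (VQ i) * z (VY i)]"

definition sfac :: "real^3^3 \<Rightarrow> (var \<Rightarrow> real) \<Rightarrow> 3 \<Rightarrow> real" where
  "sfac T z i = (T *v pt z i) $ 3"

definition act_defined :: "real^3^3 \<Rightarrow> (var \<Rightarrow> real) \<Rightarrow> bool" where
  "act_defined T z \<longleftrightarrow> (\<forall>i. sfac T z i \<noteq> 0)"

fun act :: "real^3^3 \<Rightarrow> (var \<Rightarrow> real) \<Rightarrow> var \<Rightarrow> real" where
  "act T z (VX i) = (T *v pt z i) $ 1 / sfac T z i"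
| "act T z (VY i) = (T *v pt z i) $ 2 / sfac T z i"
| "act T z (VP i) = sfac T z i * (ell z i v* matrix_inv T) $ 1"
| "act T z (VQ i) = sfac T z i * (ell z i v* matrix_inv T) $ 2"

definition jac :: "real^3^3 \<Rightarrow> (var \<Rightarrow> real) \<Rightarrow> real" where
  "jac T z = det T ^ 3 / (\<Prod>i\<in>UNIV. sfac T z i) ^ 3"

lemma pt_act:
  assumes "act_defined T z"
  shows "pt (act T z) i = (1 / sfac T z i) *\<^sub>R (T *v pt z i)"
proof -
  have "sfac T z i \<noteq> 0" using assms by (simp add: act_defined_def)
  moreover have "(T *v pt z i) $ 3 = sfac T z i" by (simp add: sfac_def)
  ultimately show ?thesis
    by (simp add: vec_eq_iff forall_3 pt_def[of "act T z"])
qed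

lemma matrix_inv_mult:
  fixes T :: "real^3^3"
  assumes "invertible T"
  shows "T ** matrix_inv T = mat 1" and "matrix_inv T ** T = mat 1"
proof -
  have "\<exists>U. T ** U = mat 1 \<and> U ** T = mat 1"
    using assms by (simp add: invertible_def)
  then have "T ** matrix_inv T = mat 1 \<and> matrix_inv T ** T = mat 1"
    unfolding matrix_inv_def by (rule someI_ex)
  then show "T ** matrix_inv T = mat 1" and "matrix_inv T ** T = mat 1" by simp_all
qed

text \<open>The third coordinate of \<open>\<ell>\<^sub>i\<close>, which \<open>act\<close> does not mention, transforms consistently.\<close>

lemma ell_act:
  assumes "invertible T" and "act_defined T z"
  shows "ell (act T z) i = sfac T z i *\<^sub>R (ell z i v* matrix_inv T)"
proof -
  let ?s = "sfac T z i" and ?u = "ell z i v* matrix_inv T" and ?w = "T *v pt z i"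
  have s: "?s \<noteq> 0" using assms by (simp add: act_defined_def)
  have w3: "?w $ 3 = ?s" by (simp add: sfac_def)
  have "?u v* T = ell z i"
    using assms(1) by (simp add: vector_matrix_mul_assoc matrix_inv_mult)
  then have "?u \<bullet> ?w = ell z i \<bullet> pt z i"
    by (metis dot_lmul_matrix)
  also have "\<dots> = 0"
    by (simp add: inner_vec_def sum_3 ell_def pt_def)
  finally have "?u $ 1 * ?w $ 1 + ?u $ 2 * ?w $ 2 + ?u $ 3 * ?s = 0"
    by (simp add: inner_vec_def sum_3 w3)
  then have "?s * ?u $ 3 = - (?u $ 1 * ?w $ 1) - ?u $ 2 * ?w $ 2"
    by (simp add: algebra_simps)
  then show ?thesis
    using s by (simp add: vec_eq_iff forall_3 ell_def[of "act T z"])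
qed

text \<open>Everything depends on \<open>T\<close> only through its class in \<open>PGL(3)\<close>, so quantifying over
  invertible \<open>T\<close> is the same as quantifying over \<open>PGL(3)\<close>.\<close>

lemma sfac_scale: "sfac (c *\<^sub>R T) z i = c * sfac T z i"
  by (simp add: sfac_def scaleR_matrix_vector_assoc[symmetric])

lemma jac_scale:
  assumes "c \<noteq> 0"
  shows "jac (c *\<^sub>R T) z = jac T z"
proof -
  have "det (c *\<^sub>R T) = c ^ 3 * det T"
    by (simp add: det_3 power3_eq_cube algebra_simps)
  moreover have "(\<Prod>i\<in>UNIV. sfac (c *\<^sub>R T) z i) = c ^ 3 * (\<Prod>i\<in>UNIV. sfac T z i)"
    by (simp add: sfac_scale prod.distrib)
  ultimately show ?thesis
    using assms by (simp add: jac_def power_mult_distrib)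
qed

lemma act_scale:
  assumes "c \<noteq> 0" and "invertible T"
  shows "act (c *\<^sub>R T) z = act T z"
proof
  fix v
  have "matrix_inv (c *\<^sub>R T) = (1 / c) *\<^sub>R matrix_inv T"
  proof -
    have inv: "invertible (c *\<^sub>R T)"
      using assms by (simp add: scalar_invertible)
    have "(1 / c) *\<^sub>R matrix_inv T ** (c *\<^sub>R T) = mat 1"
      using assms
      by (simp add: scalar_matrix_assoc[symmetric] matrix_scalar_ac matrix_inv_mult)
    then have "(1 / c) *\<^sub>R matrix_inv T ** (c *\<^sub>R T ** matrix_inv (c *\<^sub>R T)) = matrix_inv (c *\<^sub>R T)"
      by (simp add: matrix_mul_assoc)
    then show ?thesis
      by (simp add: matrix_inv_mult(1)[OF inv])
  qed
  then show "act (c *\<^sub>R T) z v = act T z v"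
    using assms(1)
    by (cases v)
      (simp_all add: sfac_scale scaleR_matrix_vector_assoc[symmetric] vector_scaleR_matrix_ac)
qed


section \<open>Absolute and relative invariants\<close>

definition A3 :: "rpoly set" where
  "A3 = {F. \<forall>T z. invertible T \<longrightarrow> act_defined T z \<longrightarrow>
              eval_poly F (act T z) = eval_poly F z}"

definition P3m1 :: "rpoly set" where
  "P3m1 = {F. \<forall>T z. invertible T \<longrightarrow> act_defined T z \<longrightarrow>
              eval_poly F (act T z) = inverse (jac T z) * eval_poly F z}"

definition D123 :: rpoly where
  "D123 = det (\<chi> i. ell Var i)"

definition C :: "3 \<Rightarrow> 3 \<Rightarrow> rpoly" where
  "C i j = (\<Sum>k\<in>UNIV. ell Var i $ k * pt Var j $ k)"


section \<open>The C-grading\<close>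

abbreviation offdiag :: "(3 \<times> 3) set" where
  "offdiag \<equiv> {(i, j). i \<noteq> j}"

definition Cmon :: "(3 \<times> 3 \<Rightarrow> nat) \<Rightarrow> rpoly" where
  "Cmon m = (\<Prod>(i, j)\<in>offdiag. C i j ^ m (i, j))"

definition Cdeg :: "(3 \<times> 3 \<Rightarrow> nat) \<Rightarrow> nat" where
  "Cdeg m = (\<Sum>ij\<in>offdiag. m ij)"

definition A3_gr :: "nat \<Rightarrow> rpoly set" where
  "A3_gr k = rpoly.span {Cmon m | m. Cmon m \<in> A3 \<and> Cdeg m = k}"

definition P3m1_gr :: "nat \<Rightarrow> rpoly set" where
  "P3m1_gr k = rpoly.span {D123 ^ d * Cmon m | d m. D123 ^ d * Cmon m \<in> P3m1 \<and> Cdeg m = k}"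

definition A3_plus :: "rpoly set" where
  "A3_plus = rpoly.span (\<Union>k\<in>{0<..}. A3_gr k)"


section \<open>Modules\<close>

text \<open>The fields \<open>mult\<close> and \<open>one\<close> of a module record play no role and are left undefined.\<close>

definition A3_ring :: "rpoly ring" where
  "A3_ring = \<lparr>carrier = A3, mult = (*), one = 1, zero = 0, add = (+)\<rparr>"

definition real_ring :: "real ring" where
  "real_ring = \<lparr>carrier = UNIV, mult = (*), one = 1, zero = 0, add = (+)\<rparr>"

definition P3m1_module :: "(rpoly, rpoly) module" where
  "P3m1_module = \<lparr>carrier = P3m1, mult = undefined, one = undefined, zero = 0, add = (+),
     smult = (*)\<rparr>"

definition P3m1_space :: "(real, rpoly) module" where
  "P3m1_space = \<lparr>carrier = P3m1, mult = undefined, one = undefined, zero = 0, add = (+),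
     smult = (\<lambda>c F. Const c * F)\<rparr>"

definition quot_module :: "('r, 'm, 'x) module_scheme \<Rightarrow> 'm set \<Rightarrow> ('r, 'm set) module" where
  "quot_module M N = \<lparr>carrier = a_rcosets\<^bsub>M\<^esub> N, mult = undefined, one = undefined,
     zero = N, add = set_add M,
     smult = (\<lambda>r X. \<Union>x\<in>X. N +>\<^bsub>M\<^esub> (r \<odot>\<^bsub>M\<^esub> x))\<rparr>"

definition module_basis ::
    "('r, 'x) ring_scheme \<Rightarrow> ('r, 'm, 'y) module_scheme \<Rightarrow> 'm set \<Rightarrow> bool" where
  "module_basis R M B \<longleftrightarrow> finite B \<and> B \<subseteq> carrier M \<and>
     (\<forall>x\<in>carrier M. \<exists>!c. c \<in> B \<rightarrow>\<^sub>E carrier R \<and> x = (\<Oplus>\<^bsub>M\<^esub>b\<in>B. c b \<odot>\<^bsub>M\<^esub> b))"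

definition free_module_of_rank ::
    "('r, 'x) ring_scheme \<Rightarrow> ('r, 'm, 'y) module_scheme \<Rightarrow> nat \<Rightarrow> bool" where
  "free_module_of_rank R M n \<longleftrightarrow>
     Module.module R M \<and> (\<exists>B. module_basis R M B \<and> card B = n)"

definition has_dimension ::
    "('r, 'x) ring_scheme \<Rightarrow> ('r, 'm, 'y) module_scheme \<Rightarrow> nat \<Rightarrow> bool" where
  "has_dimension K V n \<longleftrightarrow> Ring.field K \<and> free_module_of_rank K V n"

definition A3_plus_P3m1 :: "rpoly set" where
  "A3_plus_P3m1 = {\<Sum>k<n. a k * F k | (n::nat) a F. \<forall>k<n. a k \<in> A3_plus \<and> F k \<in> P3m1}"

definition Q3 :: "(real, rpoly set) module" where
  "Q3 = quot_module P3m1_space A3_plus_P3m1"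

definition Q3_gr :: "nat \<Rightarrow> rpoly set set" where
  "Q3_gr k = (\<lambda>F. A3_plus_P3m1 +>\<^bsub>P3m1_space\<^esub> F) ` P3m1_gr k"

end

(*
  Call F of weight w if det(T)^w F(g z) = (s_1 s_2 s_3)^w F(z), so that A_3 and P_{3,-1} are the
  weights 0 and 3. Let A be the matrix with columns A_1, A_2, A_3. Moving the three points to
  (0,0), (1,0), (0,1) shows that det(A)^w F = f(C) for a polynomial f in the C_ij. This product is an
  absolute invariant, so the torus fixing the three points forces every monomial of f to be balanced
  (each index occurs equally often as first and as second index). Balanced monomials are products of
  a = C_12 C_21, b = C_23 C_32, c = C_13 C_31, t = C_12 C_23 C_31 and t' = C_13 C_21 C_32.

  Taking determinants of (l_i A_j) gives D_123 det(A) = t + t' =: E, and t t' = a b c, whence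
  t^2 = t E - a b c. Therefore f = alpha + beta t + E f' with alpha, beta polynomials in a, b, c.
  On collinear configurations det(A) = 0, and for any real a, b, c with a b c < 0 there are two of
  them, with opposite nonzero values of t; if w > 0, this forces alpha = beta = 0. Cancelling det(A)
  leaves det(A)^(w-1) F = D_123 f'(C), and after w steps F = D_123^w G with G balanced.
*)
theory Submission
  imports Defs "HOL-Computational_Algebra.Polynomial"
begin

section \<open>Polynomials as functions\<close>

text \<open>Artin's argument: the relation at the pointwise product of \<open>y\<close> and
  \<open>x\<close>, minus \<open>ch j y\<close> times the relation at \<open>x\<close>, is a shorter
  relation with coefficients \<open>a i * (ch i y - ch j y)\<close>, and some \<open>y\<close>
  separates \<open>ch i\<close> from \<open>ch j\<close>. It serves twice, for monomials in the
  coordinates and for monomials in the values of the \<open>C i j\<close>.\<close>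

lemma characters_independent:
  fixes ch :: "'k \<Rightarrow> ('v \<Rightarrow> real) \<Rightarrow> real"
  assumes "finite I"
    and one: "\<And>i. i \<in> I \<Longrightarrow> ch i (\<lambda>_. 1) = 1"
    and mult: "\<And>i x y. i \<in> I \<Longrightarrow> ch i (\<lambda>v. x v * y v) = ch i x * ch i y"
    and inj: "inj_on ch I"
    and zero: "\<And>x. (\<Sum>i\<in>I. a i * ch i x) = 0"
  shows "\<forall>i\<in>I. a i = 0"
  using assms
proof (induction I arbitrary: a rule: finite_induct)
  case empty
  then show ?case by simp
next
  case (insert j I)
  have *: "\<forall>i\<in>I. a i * (ch i y - ch j y) = 0" for y
  proof (rule insert.IH)
    fix x
    have "(\<Sum>i\<in>I. a i * (ch i y - ch j y) * ch i x)
        = (\<Sum>i\<in>insert j I. a i * ch i (\<lambda>v. y v * x v)) - ch j y * (\<Sum>i\<in>insert j I. a i * ch i x)"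
      using insert.hyps insert.prems(2)
      by (simp add: sum_subtractf sum_distrib_left algebra_simps)
    then show "(\<Sum>i\<in>I. a i * (ch i y - ch j y) * ch i x) = 0"
      using insert.prems(4) by simp
  qed (use insert.prems in auto)
  have a0: "a i = 0" if "i \<in> I" for i
  proof -
    have "ch i \<noteq> ch j" using insert.prems(3) insert.hyps(2) that by (auto simp: inj_on_def)
    then obtain y where "ch i y \<noteq> ch j y" by blast
    then show ?thesis using *[of y] that by auto
  qed
  moreover have "a j = 0"
    using insert.prems(4)[of "\<lambda>_. 1"] insert.prems(1)[of j] insert.hyps a0 by simp
  ultimately show ?case by simp
qed

definition monomial_value :: "(var \<Rightarrow>\<^sub>0 nat) \<Rightarrow> (var \<Rightarrow> real) \<Rightarrow> real" where
  "monomial_value m z = (\<Prod>v\<in>Poly_Mapping.keys m. z v ^ Poly_Mapping.lookup m v)"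

lemma monomial_value_superset:
  assumes "finite V" "Poly_Mapping.keys m \<subseteq> V"
  shows "monomial_value m z = (\<Prod>v\<in>V. z v ^ Poly_Mapping.lookup m v)"
  unfolding monomial_value_def using assms
  by (intro prod.mono_neutral_left) (auto simp: in_keys_iff)

lemma monomial_value_0 [simp]: "monomial_value 0 z = 1"
  by (simp add: monomial_value_def)

lemma monomial_value_add: "monomial_value (m + n) z = monomial_value m z * monomial_value n z"
proof -
  let ?V = "Poly_Mapping.keys m \<union> Poly_Mapping.keys n"
  have "finite ?V" by simp
  then show ?thesis
    using monomial_value_superset[of ?V "m + n" z] monomial_value_superset[of ?V m z] monomial_value_superset[of ?V n z]
    by (simp add: Poly_Mapping.keys_add lookup_add power_add prod.distrib)
qed

lemma eval_poly_superset:
  assumes "finite M" "Poly_Mapping.keys F \<subseteq> M"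
  shows "eval_poly F z = (\<Sum>m\<in>M. Poly_Mapping.lookup F m * monomial_value m z)"
  unfolding eval_poly_def monomial_value_def[symmetric] using assms
  by (intro sum.mono_neutral_left) (auto simp: in_keys_iff)

lemma eval_poly_add [simp]: "eval_poly (F + G) z = eval_poly F z + eval_poly G z"
proof -
  let ?M = "Poly_Mapping.keys F \<union> Poly_Mapping.keys G"
  have "finite ?M" by simp
  then show ?thesis
    using eval_poly_superset[of ?M "F + G" z] eval_poly_superset[of ?M F z] eval_poly_superset[of ?M G z]
    by (simp add: Poly_Mapping.keys_add lookup_add distrib_right sum.distrib)
qed

lemma eval_poly_0 [simp]: "eval_poly 0 z = 0"
  by (simp add: eval_poly_def)

lemma eval_poly_single [simp]: "eval_poly (Poly_Mapping.single m c) z = c * monomial_value m z"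
  by (simp add: eval_poly_def monomial_value_def)

lemma eval_poly_sum [simp]: "eval_poly (sum f A) z = (\<Sum>x\<in>A. eval_poly (f x) z)"
  by (induction A rule: infinite_finite_induct) auto

lemma rpoly_expand:
  "F = (\<Sum>m\<in>Poly_Mapping.keys F. Poly_Mapping.single m (Poly_Mapping.lookup F m))"
  by (rule poly_mapping_eqI)
    (auto simp: lookup_sum lookup_single when_def in_keys_iff sum.delta)

lemma eval_poly_mult [simp]: "eval_poly (F * G) z = eval_poly F z * eval_poly G z"
proof -
  have "eval_poly (F * G) z = eval_poly
     ((\<Sum>m\<in>Poly_Mapping.keys F. Poly_Mapping.single m (Poly_Mapping.lookup F m)) *
      (\<Sum>n\<in>Poly_Mapping.keys G. Poly_Mapping.single n (Poly_Mapping.lookup G n))) z"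
    by (simp only: rpoly_expand[symmetric])
  also have "\<dots> = (\<Sum>m\<in>Poly_Mapping.keys F. \<Sum>n\<in>Poly_Mapping.keys G.
      (Poly_Mapping.lookup F m * monomial_value m z) * (Poly_Mapping.lookup G n * monomial_value n z))"
    by (simp add: sum_product mult_single monomial_value_add mult.assoc mult.left_commute)
  also have "\<dots> = eval_poly F z * eval_poly G z"
    by (simp only: sum_product[symmetric] eval_poly_def monomial_value_def)
  finally show ?thesis .
qed

lemma eval_poly_Const [simp]: "eval_poly (Const c) z = c"
  by (simp add: Const_def)

lemma eval_poly_Var [simp]: "eval_poly (Var v) z = z v"
  by (simp add: Var_def monomial_value_def)

lemma Const_1 [simp]: "Const 1 = 1"
  by (simp add: Const_def)

lemma Const_0 [simp]: "Const 0 = 0"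
  by (simp add: Const_def)

lemma Const_mult: "Const (c * d) = Const c * Const d"
  by (simp add: Const_def mult_single)

lemma Const_add: "Const (c + d) = Const c + Const d"
  by (simp add: Const_def single_add)

lemma eval_poly_1 [simp]: "eval_poly 1 z = 1"
  using eval_poly_Const[of 1 z] by simp

lemma eval_poly_uminus [simp]: "eval_poly (- F) z = - eval_poly F z"
  using eval_poly_add[of F "- F" z] by simp

lemma eval_poly_diff [simp]: "eval_poly (F - G) z = eval_poly F z - eval_poly G z"
  using eval_poly_add[of F "- G" z] by simp

lemma eval_poly_prod [simp]: "eval_poly (prod f A) z = (\<Prod>x\<in>A. eval_poly (f x) z)"
  by (induction A rule: infinite_finite_induct) auto

lemma eval_poly_power [simp]: "eval_poly (F ^ n) z = eval_poly F z ^ n"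
  by (induction n) auto

text \<open>At the point with coordinate 2 at \<open>v\<close> and 1 elsewhere, a monomial takes the
  value 2 to the exponent of \<open>v\<close>, which recovers that exponent.\<close>

lemma monomial_value_inj: "inj monomial_value"
proof (rule injI, rule poly_mapping_eqI)
  fix m n v assume mn: "monomial_value m = monomial_value n"
  have *: "monomial_value k (\<lambda>u. if u = v then 2 else 1) = 2 ^ Poly_Mapping.lookup k v" for k
  proof -
    have "monomial_value k (\<lambda>u. if u = v then 2 else 1)
        = (\<Prod>u\<in>insert v (Poly_Mapping.keys k). (if u = v then 2 else 1) ^ Poly_Mapping.lookup k u)"
      by (rule monomial_value_superset) auto
    also have "\<dots> = (\<Prod>u\<in>{v}. (if u = v then 2 else 1) ^ Poly_Mapping.lookup k u)"
      by (rule prod.mono_neutral_right) auto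
    finally show ?thesis by simp
  qed
  show "Poly_Mapping.lookup m v = Poly_Mapping.lookup n v"
    using *[of m] *[of n] mn by simp
qed

text \<open>Distinct monomials are distinct multiplicative characters, so a difference that vanishes
  as a function has only zero coefficients. Polynomial identities can from here on be checked
  pointwise.\<close>

lemma eval_poly_inject:
  assumes "\<And>z. eval_poly F z = eval_poly G z"
  shows "F = G"
proof -
  let ?H = "F - G"
  have "\<forall>m\<in>Poly_Mapping.keys ?H. Poly_Mapping.lookup ?H m = 0"
  proof (rule characters_independent[where ch = monomial_value])
    show "inj_on monomial_value (Poly_Mapping.keys ?H)" using monomial_value_inj by (rule inj_on_subset) simp
    show "(\<Sum>m\<in>Poly_Mapping.keys ?H. Poly_Mapping.lookup ?H m * monomial_value m z) = 0" for z
      using assms[of z] eval_poly_superset[OF finite_keys subset_refl, of ?H z] by simp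
  qed (auto simp: monomial_value_def power_mult_distrib prod.distrib)
  then have "?H = 0" by (intro poly_mapping_eqI) (metis in_keys_iff lookup_zero)
  then show ?thesis by simp
qed

section \<open>Density of open sets and cancellation\<close>

lemma eval_poly_on_line:
  "\<exists>p. \<forall>s. eval_poly F (\<lambda>v. z v + s * d v) = poly p s"
proof -
  let ?q = "\<Sum>m\<in>Poly_Mapping.keys F. [:Poly_Mapping.lookup F m:] *
        (\<Prod>v\<in>Poly_Mapping.keys m. [:z v, d v:] ^ Poly_Mapping.lookup m v)"
  have "eval_poly F (\<lambda>v. z v + s * d v) = poly ?q s" for s
    by (simp add: eval_poly_def poly_sum poly_prod mult.commute)
  then show ?thesis by blast
qed

text \<open>A nonempty open set is Zariski dense. On the line from \<open>z\<^sub>0\<close> to any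
  \<open>z\<close>, \<open>P\<close> stays negative near parameter 0, so \<open>H\<close> restricts
  to a univariate polynomial with infinitely many roots.\<close>

lemma eval_poly_eq_0_if_vanishing:
  assumes "eval_poly P z\<^sub>0 < 0" and zero: "\<And>z. eval_poly P z < 0 \<Longrightarrow> eval_poly H z = 0"
  shows "H = 0"
proof (rule eval_poly_inject)
  fix z
  let ?l = "\<lambda>s v. z\<^sub>0 v + s * (z v - z\<^sub>0 v)"
  obtain p h where p: "\<And>s. eval_poly P (?l s) = poly p s" and h: "\<And>s. eval_poly H (?l s) = poly h s"
    using eval_poly_on_line[of P z\<^sub>0 "\<lambda>v. z v - z\<^sub>0 v"] eval_poly_on_line[of H z\<^sub>0 "\<lambda>v. z v - z\<^sub>0 v"]
    by blast
  have "poly p 0 < 0" using assms(1) p[of 0] by simp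
  moreover have "isCont (poly p) 0" by simp
  ultimately have "eventually (\<lambda>s. poly p s < 0) (at 0)"
    using order_tendstoD(2)[of "poly p" "poly p 0" "at 0" 0] by (simp add: isCont_def)
  then obtain e where e: "e > 0" "\<And>s. s \<noteq> 0 \<Longrightarrow> dist s 0 < e \<Longrightarrow> poly p s < 0"
    by (auto simp: eventually_at)
  have "{0<..<e} \<subseteq> {s. poly h s = 0}"
  proof
    fix s assume "s \<in> {0<..<e}"
    then have "eval_poly P (?l s) < 0" using e(2)[of s] p by simp
    then show "s \<in> {s. poly h s = 0}" using zero[of "?l s"] by (simp add: h)
  qed
  moreover have "infinite {0<..<e}" using e(1) by simp
  ultimately have "h = 0" using poly_roots_finite finite_subset by blast
  \<comment> \<open>The line reaches \<open>z\<close> at parameter 1.\<close>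
  then show "eval_poly H z = eval_poly 0 z" using h[of 1] by simp
qed

text \<open>The open set used is the complement of the zero set of \<open>H\<close>, described as
  the set where \<open>- (H * H)\<close> is negative.\<close>

lemma rpoly_mult_cancel:
  fixes F G H :: rpoly
  assumes "H \<noteq> 0" and "H * F = H * G"
  shows "F = G"
proof -
  obtain z\<^sub>0 where "eval_poly H z\<^sub>0 \<noteq> 0" using assms(1) eval_poly_inject[of H 0] by auto
  then have "eval_poly (- (H * H)) z\<^sub>0 < 0"
    by (auto simp: zero_less_mult_iff linorder_neq_iff)
  then have "F - G = 0"
  proof (rule eval_poly_eq_0_if_vanishing)
    fix z assume "eval_poly (- (H * H)) z < 0"
    moreover have "eval_poly H z * eval_poly F z = eval_poly H z * eval_poly G z"
      using assms(2) by (metis eval_poly_mult)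
    ultimately show "eval_poly (F - G) z = 0" by auto
  qed
  then show ?thesis by simp
qed

section \<open>Relative invariants and the reduction to three fixed points\<close>

text \<open>Clearing denominators avoids negative powers of \<open>jac\<close>: the factor
  \<open>inverse (jac T z)\<close> becomes weight 3. A general weight makes products and powers of
  \<open>D123\<close> easy to track.\<close>

definition rel_inv :: "nat \<Rightarrow> rpoly set" where
  "rel_inv w = {F. \<forall>T z. invertible T \<longrightarrow> act_defined T z \<longrightarrow>
     det T ^ w * eval_poly F (act T z) = (\<Prod>i\<in>UNIV. sfac T z i) ^ w * eval_poly F z}"

lemma A3_eq_rel_inv: "A3 = rel_inv 0"
  by (simp add: A3_def rel_inv_def)

lemma P3m1_eq_rel_inv: "P3m1 = rel_inv 3"
proof -
  have "eval_poly F (act T z) = inverse (jac T z) * eval_poly F z \<longleftrightarrow>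
      det T ^ 3 * eval_poly F (act T z) = (\<Prod>i\<in>UNIV. sfac T z i) ^ 3 * eval_poly F z"
    if "invertible T" for F T z
    using that by (auto simp: jac_def invertible_det_nz field_simps)
  then show ?thesis by (auto simp: P3m1_def rel_inv_def)
qed

lemma rel_inv_mult:
  assumes "F \<in> rel_inv w" "G \<in> rel_inv w'"
  shows "F * G \<in> rel_inv (w + w')"
  unfolding rel_inv_def
proof (intro CollectI allI impI)
  fix T z assume T: "invertible T" "act_defined T z"
  let ?s = "\<Prod>i\<in>UNIV. sfac T z i"
  have "det T ^ w * eval_poly F (act T z) * (det T ^ w' * eval_poly G (act T z))
      = ?s ^ w * eval_poly F z * (?s ^ w' * eval_poly G z)"
    using assms T by (simp add: rel_inv_def)
  then show "det T ^ (w + w') * eval_poly (F * G) (act T z) = ?s ^ (w + w') * eval_poly (F * G) z"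
    by (simp add: power_add algebra_simps)
qed

lemma A3_Const: "Const c \<in> A3"
  by (simp add: A3_def)

lemma A3_add: "F \<in> A3 \<Longrightarrow> G \<in> A3 \<Longrightarrow> F + G \<in> A3"
  by (simp add: A3_def)

lemma A3_mult: "F \<in> A3 \<Longrightarrow> G \<in> A3 \<Longrightarrow> F * G \<in> A3"
  by (simp add: A3_def)

lemma subspace_A3: "rpoly.subspace A3"
  by (rule rpoly.subspaceI) (auto simp: A3_def)

lemma eval_poly_pt [simp]: "eval_poly (pt Var i $ k) z = pt z i $ k"
  using exhaust_3[of k] by (auto simp: pt_def)

lemma eval_poly_ell [simp]: "eval_poly (ell Var i $ k) z = ell z i $ k"
  using exhaust_3[of k] by (auto simp: ell_def)

lemma eval_poly_C: "eval_poly (C i j) z = ell z i \<bullet> pt z j"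
  by (simp add: C_def inner_vec_def)

lemma eval_poly_C_coords:
  "eval_poly (C i j) z = z (VP i) * (z (VX j) - z (VX i)) + z (VQ i) * (z (VY j) - z (VY i))"
  by (simp add: eval_poly_C inner_vec_def sum_3 ell_def pt_def algebra_simps)

lemma C_diag [simp]: "C i i = 0"
  by (rule eval_poly_inject) (simp add: eval_poly_C_coords)

lemma eval_poly_D123: "eval_poly D123 z = det (\<chi> i. ell z i)"
  by (simp add: D123_def det_3)

definition detA :: rpoly where
  "detA = det (\<chi> i. pt Var i)"

lemma eval_poly_detA: "eval_poly detA z = det (\<chi> i. pt z i)"
  by (simp add: detA_def det_3)

text \<open>Rows times columns give the matrix of the \<open>C i j\<close>. Its diagonal vanishes,
  so only the two 3-cycles contribute to the determinant. The transpose appears because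
  \<open>detA\<close> stores the points as rows.\<close>

lemma D123_mult_detA: "D123 * detA = C 1 2 * C 2 3 * C 3 1 + C 1 3 * C 2 1 * C 3 2"
proof (rule eval_poly_inject)
  fix z
  have "eval_poly (D123 * detA) z = det ((\<chi> i. ell z i) ** transpose (\<chi> i. pt z i))"
    by (simp add: eval_poly_D123 eval_poly_detA det_mul det_transpose)
  also have "(\<chi> i. ell z i) ** transpose (\<chi> i. pt z i) = (\<chi> i j. eval_poly (C i j) z)"
    by (simp add: vec_eq_iff matrix_matrix_mult_def transpose_def eval_poly_C inner_vec_def)
  finally show "eval_poly (D123 * detA) z = eval_poly (C 1 2 * C 2 3 * C 3 1 + C 1 3 * C 2 1 * C 3 2) z"
    by (simp add: det_3)
qed

lemma det_scale_rows:
  fixes M :: "real^3^3"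
  shows "det (\<chi> i. c i *\<^sub>R (M $ i)) = (\<Prod>i\<in>UNIV. c i) * det M"
  using det_rows_mul[of c "\<lambda>i. M $ i"] by (simp add: scalar_mult_eq_scaleR)

lemma detA_act:
  assumes "act_defined T z"
  shows "(\<Prod>i\<in>UNIV. sfac T z i) * eval_poly detA (act T z) = det T * eval_poly detA z"
proof -
  have "eval_poly detA (act T z) = det (\<chi> i. (1 / sfac T z i) *\<^sub>R ((\<chi> i. T *v pt z i) $ i))"
    by (simp add: eval_poly_detA pt_act[OF assms])
  also have "\<dots> = (\<Prod>i\<in>UNIV. 1 / sfac T z i) * det (\<chi> i. T *v pt z i)"
    by (rule det_scale_rows)
  also have "(\<chi> i. T *v pt z i) = transpose (T ** transpose (\<chi> i. pt z i))"
    by (simp add: vec_eq_iff matrix_matrix_mult_def matrix_vector_mult_def transpose_def)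
  also have "det \<dots> = det T * eval_poly detA z"
    by (simp add: det_transpose det_mul eval_poly_detA)
  finally show ?thesis
    using assms by (simp add: act_defined_def prod_dividef)
qed

lemma D123_act:
  assumes "invertible T" "act_defined T z"
  shows "det T * eval_poly D123 (act T z) = (\<Prod>i\<in>UNIV. sfac T z i) * eval_poly D123 z"
proof -
  have "eval_poly D123 (act T z) = det (\<chi> i. sfac T z i *\<^sub>R ((\<chi> i. ell z i v* matrix_inv T) $ i))"
    by (simp add: eval_poly_D123 ell_act[OF assms])
  also have "\<dots> = (\<Prod>i\<in>UNIV. sfac T z i) * det (\<chi> i. ell z i v* matrix_inv T)"
    by (rule det_scale_rows)
  also have "(\<chi> i. ell z i v* matrix_inv T) = (\<chi> i. ell z i) ** matrix_inv T"
    by (simp add: vec_eq_iff matrix_matrix_mult_def vector_matrix_mult_def mult.commute)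
  also have "det \<dots> = eval_poly D123 z * det (matrix_inv T)"
    by (simp add: det_mul eval_poly_D123)
  finally show ?thesis
    using matrix_inv_mult(1)[OF assms(1)] det_mul[of T "matrix_inv T"]
    by (simp add: mult.assoc mult.left_commute[of "det T"])
qed

text \<open>\<open>T\<close> and its inverse cancel in the pairing, leaving only the scalar factors
  of the covector and of the point.\<close>

lemma C_act:
  assumes "invertible T" "act_defined T z"
  shows "eval_poly (C i j) (act T z) = sfac T z i / sfac T z j * eval_poly (C i j) z"
proof -
  have "(ell z i v* matrix_inv T) \<bullet> (T *v pt z j) = ell z i \<bullet> (matrix_inv T *v (T *v pt z j))"
    by (simp add: dot_lmul_matrix)
  also have "\<dots> = ell z i \<bullet> pt z j"
    by (simp add: matrix_vector_mul_assoc matrix_inv_mult[OF assms(1)])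
  finally show ?thesis
    by (simp add: eval_poly_C ell_act[OF assms] pt_act[OF assms(2)])
qed

lemma D123_rel_inv: "D123 \<in> rel_inv 1"
  by (simp add: rel_inv_def D123_act)

lemma D123_power_rel_inv: "D123 ^ n \<in> rel_inv n"
proof (induction n)
  case 0
  then show ?case using A3_Const[of 1] by (simp add: A3_eq_rel_inv)
next
  case (Suc n)
  then show ?case using rel_inv_mult[OF D123_rel_inv Suc] by simp
qed

section \<open>Normal form: the three points at \<open>(0,0)\<close>, \<open>(1,0)\<close>,
  \<open>(0,1)\<close>\<close>

definition base_pt :: "3 \<Rightarrow> real^3" where
  "base_pt j = vector [if j = 2 then 1 else 0, if j = 3 then 1 else 0, 1]"

definition base_mat :: "real^3^3" where
  "base_mat = (\<chi> j. base_pt j)"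

lemma det_base_mat [simp]: "det base_mat = 1"
  by (simp add: det_3 base_mat_def base_pt_def)

text \<open>The configuration over the three base points whose pairings are the prescribed
  \<open>c\<close>: there \<open>C i 2 - C i 1\<close> is the first covector coordinate and
  \<open>C i 3 - C i 1\<close> the second. The type is polymorphic so that \<open>c\<close> may
  consist of real values or of the polynomials \<open>C i j\<close> themselves.\<close>

definition slice :: "(3 \<times> 3 \<Rightarrow> 'a::comm_ring_1) \<Rightarrow> var \<Rightarrow> 'a" where
  "slice c v = (case v of VX i \<Rightarrow> if i = 2 then 1 else 0 | VY i \<Rightarrow> if i = 3 then 1 else 0
     | VP i \<Rightarrow> c (i, 2) - c (i, 1) | VQ i \<Rightarrow> c (i, 3) - c (i, 1))"

lemma pt_slice: "pt (slice c) i = base_pt i"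
  by (simp add: pt_def slice_def base_pt_def)

lemma C_slice:
  assumes "c (i, i) = 0"
  shows "eval_poly (C i j) (slice c) = c (i, j)"
  using assms exhaust_3[of i] exhaust_3[of j]
  by (auto simp: eval_poly_C_coords slice_def)

text \<open>The base points have third coordinate 1, so all factors \<open>sfac\<close> are 1. Hence
  the values of the \<open>C i j\<close> are unchanged, and these determine the covectors over the
  base points.\<close>

lemma act_to_slice:
  assumes T: "invertible T" "\<And>i. T *v pt z i = base_pt i"
  shows "act_defined T z" "\<And>i. sfac T z i = 1"
    "act T z = slice (\<lambda>(i, j). eval_poly (C i j) z)"
proof -
  show s: "sfac T z i = 1" for i
    by (simp add: sfac_def T(2) base_pt_def)
  then show d: "act_defined T z" by (simp add: act_defined_def)
  have pt: "pt (act T z) i = base_pt i" for i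
    by (simp add: pt_act[OF d] s T(2))
  have x: "act T z (VX i) = (if i = 2 then 1 else 0)" "act T z (VY i) = (if i = 3 then 1 else 0)" for i
    using arg_cong[OF pt[of i], of "\<lambda>u. u $ 1"] arg_cong[OF pt[of i], of "\<lambda>u. u $ 2"]
    by (simp_all add: pt_def base_pt_def del: act.simps)
  have c: "ell (act T z) i \<bullet> base_pt j = eval_poly (C i j) z" for i j
    using C_act[OF T(1) d, of i j] by (simp add: eval_poly_C pt s)
  have p: "act T z (VP i) = eval_poly (C i 2) z - eval_poly (C i 1) z" for i
    using c[of i 2] c[of i 1] by (simp add: inner_vec_def sum_3 base_pt_def ell_def del: act.simps)
  have q: "act T z (VQ i) = eval_poly (C i 3) z - eval_poly (C i 1) z" for i
    using c[of i 3] c[of i 1] by (simp add: inner_vec_def sum_3 base_pt_def ell_def del: act.simps)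
  show "act T z = slice (\<lambda>(i, j). eval_poly (C i j) z)"
  proof
    fix v show "act T z v = slice (\<lambda>(i, j). eval_poly (C i j) z) v"
      by (cases v) (simp_all add: slice_def x p q del: act.simps)
  qed
qed

lemma transposed_row: "transpose M *v axis i 1 = (M :: real^3^3) $ i"
  by (simp add: matrix_vector_mul_component vec_eq_iff transpose_def matrix_vector_mult_def axis_def if_distrib cong: if_cong)

text \<open>Provides both the map to the base points and the torus elements that fix them
  projectively.\<close>

lemma ex_T_on_points:
  fixes M N :: "real^3^3"
  assumes "det M \<noteq> 0" "det N \<noteq> 0"
  obtains T where "invertible T" "\<And>i. T *v (M $ i) = N $ i" "det T * det M = det N"
proof
  let ?T = "transpose N ** matrix_inv (transpose M)"
  have M: "invertible (transpose M)" using assms by (simp add: invertible_det_nz det_transpose)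
  have TM: "?T ** transpose M = transpose N"
    by (simp add: matrix_mul_assoc[symmetric] matrix_inv_mult[OF M])
  show "?T *v (M $ i) = N $ i" for i
    by (metis TM matrix_vector_mul_assoc transposed_row)
  show d: "det ?T * det M = det N"
    using arg_cong[OF TM, of det] by (simp only: det_mul det_transpose)
  show "invertible ?T" using d assms unfolding invertible_det_nz by auto
qed

section \<open>Polynomials in the \<open>C i j\<close>\<close>

definition Cpoly :: "rpoly set" where
  "Cpoly = rpoly.span (range Cmon)"

lemma Cmon_add: "Cmon (\<lambda>x. m x + n x) = Cmon m * Cmon n"
  by (simp add: Cmon_def power_add prod.distrib split_def)

lemma Cmon_0: "Cmon (\<lambda>_. 0) = 1"
  by (simp add: Cmon_def split_def)

lemma offdiag_eq: "offdiag = {(1,2), (1,3), (2,1), (2,3), (3,1), (3,2)}"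
  by (simp add: set_eq_iff forall_3)

lemma prod_offdiag:
  fixes f :: "3 \<times> 3 \<Rightarrow> 'a::comm_monoid_mult"
  shows "prod f offdiag = f (1,2) * f (1,3) * f (2,1) * f (2,3) * f (3,1) * f (3,2)"
  by (simp add: offdiag_eq mult.assoc)

lemma C_in_Cpoly: "C i j \<in> Cpoly"
proof (cases "i = j")
  case True
  then show ?thesis by (simp add: Cpoly_def rpoly.span_zero)
next
  case False
  have "Cmon (\<lambda>x. if x = (i, j) then 1 else 0) = C i j"
  proof -
    have "Cmon (\<lambda>x. if x = (i, j) then 1 else 0) = (\<Prod>x\<in>offdiag. if x = (i, j) then C i j else 1)"
      unfolding Cmon_def by (rule prod.cong) (auto split: if_splits)
    then show ?thesis using False by (simp add: prod.delta)
  qed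
  then show ?thesis unfolding Cpoly_def by (metis rangeI rpoly.span_base)
qed

lemma Cpoly_add: "F \<in> Cpoly \<Longrightarrow> G \<in> Cpoly \<Longrightarrow> F + G \<in> Cpoly"
  unfolding Cpoly_def by (rule rpoly.span_add)

lemma Cpoly_diff: "F \<in> Cpoly \<Longrightarrow> G \<in> Cpoly \<Longrightarrow> F - G \<in> Cpoly"
  unfolding Cpoly_def by (rule rpoly.span_diff)

lemma Cpoly_1: "1 \<in> Cpoly"
  unfolding Cpoly_def by (metis Cmon_0 rangeI rpoly.span_base)

lemma Cpoly_0: "0 \<in> Cpoly"
  unfolding Cpoly_def by (rule rpoly.span_zero)

lemma Cpoly_scale: "F \<in> Cpoly \<Longrightarrow> Const c * F \<in> Cpoly"
  unfolding Cpoly_def by (rule rpoly.span_scale)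

lemma Cpoly_mult:
  assumes "F \<in> Cpoly" "G \<in> Cpoly"
  shows "F * G \<in> Cpoly"
proof -
  have *: "Cmon m * G \<in> Cpoly" for m
    using assms(2) unfolding Cpoly_def
  proof (induction rule: rpoly.span_induct_alt)
    case base
    then show ?case by (simp add: rpoly.span_zero)
  next
    case (step c x y)
    then obtain n where "x = Cmon n" by auto
    then have "Cmon m * (Const c * x + y) = Const c * Cmon (\<lambda>x. m x + n x) + Cmon m * y"
      by (simp add: Cmon_add algebra_simps)
    then show ?case using step by (simp add: rpoly.span_add rpoly.span_scale rpoly.span_base)
  qed
  show ?thesis
    using assms(1) unfolding Cpoly_def
  proof (induction rule: rpoly.span_induct_alt)
    case base
    then show ?case by (simp add: rpoly.span_zero)
  next
    case (step c x y)
    then have "x * G \<in> rpoly.span (range Cmon)" using * by (auto simp: Cpoly_def)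
    then show ?case
      using step by (simp add: distrib_right mult.assoc rpoly.span_add rpoly.span_scale)
  qed
qed

lemma Cpoly_power: "F \<in> Cpoly \<Longrightarrow> F ^ n \<in> Cpoly"
  by (induction n) (auto intro: Cpoly_1 Cpoly_mult)

lemma Cpoly_prod: "(\<And>x. x \<in> A \<Longrightarrow> f x \<in> Cpoly) \<Longrightarrow> prod f A \<in> Cpoly"
  by (induction A rule: infinite_finite_induct) (auto intro: Cpoly_1 Cpoly_mult)

lemma Cpoly_sum: "(\<And>x. x \<in> A \<Longrightarrow> f x \<in> Cpoly) \<Longrightarrow> sum f A \<in> Cpoly"
  by (induction A rule: infinite_finite_induct) (auto intro: Cpoly_0 Cpoly_add)

lemma detA_nonzero: "detA \<noteq> 0"
proof
  assume "detA = 0"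
  then have "eval_poly detA (slice (\<lambda>_. 0)) = 0" by simp
  then have "det base_mat = 0"
    unfolding base_mat_def eval_poly_detA pt_slice .
  then show False by simp
qed

text \<open>The substitution of \<open>slice\<close> of the \<open>C i j\<close> for the variables;
  for relative invariants it yields the polynomial \<open>f\<close> of the overview.\<close>

definition restrict_to_slice :: "rpoly \<Rightarrow> rpoly" where
  "restrict_to_slice F = (\<Sum>m\<in>Poly_Mapping.keys F. Const (Poly_Mapping.lookup F m) *
     (\<Prod>v\<in>Poly_Mapping.keys m. slice (\<lambda>(i, j). C i j) v ^ Poly_Mapping.lookup m v))"

lemma eval_restrict_to_slice:
  "eval_poly (restrict_to_slice F) z = eval_poly F (slice (\<lambda>(i, j). eval_poly (C i j) z))"
proof -
  have "eval_poly (slice (\<lambda>(i, j). C i j) v) z = slice (\<lambda>(i, j). eval_poly (C i j) z) v" for v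
    by (cases v) (simp_all add: slice_def)
  then show ?thesis by (simp add: restrict_to_slice_def eval_poly_def[of F])
qed

lemma restrict_to_slice_Cpoly: "restrict_to_slice F \<in> Cpoly"
proof -
  have "slice (\<lambda>(i, j). C i j) v \<in> Cpoly" for v
    by (cases v) (auto simp: slice_def intro: Cpoly_0 Cpoly_1 Cpoly_diff C_in_Cpoly)
  then show ?thesis
    unfolding restrict_to_slice_def
    by (intro Cpoly_sum Cpoly_scale Cpoly_prod Cpoly_power)
qed

text \<open>For noncollinear points the transformation to the base points has determinant inverse to
  \<open>detA\<close> and all \<open>sfac\<close> equal to 1, so the weight law expresses
  \<open>detA ^ w * F\<close> through the normal form.\<close>

lemma detA_power_mult_Cpoly:
  assumes F: "F \<in> rel_inv w"
  shows "detA ^ w * F \<in> Cpoly"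
proof -
  \<comment> \<open>The extra factor \<open>detA\<close> makes the identity trivial on collinear
    configurations; it is cancelled afterwards.\<close>
  have "detA * (detA ^ w * F) = detA * restrict_to_slice F"
  proof (rule eval_poly_inject)
    fix z
    have "eval_poly detA z ^ w * eval_poly F z = eval_poly F (slice (\<lambda>(i, j). eval_poly (C i j) z))"
      if nz: "eval_poly detA z \<noteq> 0"
    proof -
      have "det (\<chi> i. pt z i) \<noteq> 0" "det base_mat \<noteq> 0"
        using nz by (simp_all add: eval_poly_detA)
      then obtain T where T: "invertible T" "\<And>i. T *v ((\<chi> i. pt z i) $ i) = base_mat $ i"
        "det T * det (\<chi> i. pt z i) = det base_mat"
        using ex_T_on_points by blast
      have "T *v pt z i = base_pt i" for i using T(2)[of i] by (simp add: base_mat_def)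
      note sl = act_to_slice[OF T(1) this]
      have "det T ^ w * eval_poly F (act T z) = eval_poly F z"
        using F T(1) sl(1) by (simp add: rel_inv_def sl(2))
      moreover have "det T * eval_poly detA z = 1"
        using T(3) by (simp add: eval_poly_detA)
      then have "eval_poly detA z ^ w * det T ^ w = 1"
        by (simp add: power_mult_distrib[symmetric] mult.commute)
      ultimately have "eval_poly detA z ^ w * eval_poly F z = eval_poly F (act T z)"
        by (metis mult.assoc mult_1)
      then show ?thesis by (simp only: sl(3))
    qed
    then show "eval_poly (detA * (detA ^ w * F)) z = eval_poly (detA * restrict_to_slice F) z"
      by (cases "eval_poly detA z = 0") (simp_all add: eval_restrict_to_slice)
  qed
  then have "detA ^ w * F = restrict_to_slice F" by (rule rpoly_mult_cancel[OF detA_nonzero])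
  then show ?thesis using restrict_to_slice_Cpoly by simp
qed

text \<open>By \<open>detA_act\<close>, \<open>detA\<close> behaves like an element of weight -1,
  which offsets the weight of \<open>F\<close>.\<close>

lemma detA_power_mult_A3:
  assumes F: "F \<in> rel_inv w"
  shows "detA ^ w * F \<in> A3"
  unfolding A3_def
proof (intro CollectI allI impI)
  fix T z assume T: "invertible T" "act_defined T z"
  let ?s = "\<Prod>i\<in>UNIV. sfac T z i"
  have s: "?s \<noteq> 0" using T(2) by (simp add: act_defined_def)
  have d: "det T \<noteq> 0" using T(1) by (simp add: invertible_det_nz)
  have 1: "det T ^ w * eval_poly F (act T z) = ?s ^ w * eval_poly F z"
    using F T by (simp add: rel_inv_def)
  have 2: "?s ^ w * eval_poly detA (act T z) ^ w = det T ^ w * eval_poly detA z ^ w"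
    by (metis detA_act[OF T(2)] power_mult_distrib)
  have "(?s ^ w * det T ^ w) * (eval_poly detA (act T z) ^ w * eval_poly F (act T z))
      = (?s ^ w * det T ^ w) * (eval_poly detA z ^ w * eval_poly F z)"
    using arg_cong2[OF 1 2, of "(*)"] by (simp only: mult_ac)
  then show "eval_poly (detA ^ w * F) (act T z) = eval_poly (detA ^ w * F) z"
    using s d by simp
qed

section \<open>Torus weights of monomials in the \<open>C i j\<close>\<close>

text \<open>Balance at the index \<open>3\<close> follows from balance at \<open>1\<close> and \<open>2\<close>.\<close>

definition balanced :: "(3 \<times> 3 \<Rightarrow> nat) \<Rightarrow> bool" where
  "balanced m \<longleftrightarrow> m (1,2) + m (1,3) = m (2,1) + m (3,1) \<and> m (2,1) + m (2,3) = m (1,2) + m (3,2)"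

text \<open>The monomial as a function of the values of the \<open>C i j\<close>; multiplicative in
  \<open>c\<close>, as \<open>characters_independent\<close> requires.\<close>

definition Cchar :: "(3 \<times> 3 \<Rightarrow> nat) \<Rightarrow> (3 \<times> 3 \<Rightarrow> real) \<Rightarrow> real" where
  "Cchar m c = (\<Prod>x\<in>offdiag. c x ^ m x)"

lemma eval_poly_Cmon: "eval_poly (Cmon m) z = Cchar m (\<lambda>(i, j). eval_poly (C i j) z)"
  by (simp add: Cmon_def Cchar_def split_def)

lemma Cchar_mult: "Cchar m (\<lambda>x. c x * d x) = Cchar m c * Cchar m d"
  by (simp add: Cchar_def power_mult_distrib prod.distrib)

text \<open>Each \<open>s k\<close> occurs above the bar once per use of \<open>k\<close> as first
  index and below it once per use as second index, so balance is exactly the equality of the two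
  exponents.\<close>

lemma Cchar_quotient:
  "Cchar m (\<lambda>(i, j). s i / s j) =
    s 1 ^ (m (1,2) + m (1,3)) * s 2 ^ (m (2,1) + m (2,3)) * s 3 ^ (m (3,1) + m (3,2)) /
    (s 1 ^ (m (2,1) + m (3,1)) * s 2 ^ (m (1,2) + m (3,2)) * s 3 ^ (m (1,3) + m (2,3)))"
  by (simp add: Cchar_def prod_offdiag power_divide power_add mult_ac)

lemma Cmon_act:
  assumes "invertible T" "act_defined T z"
  shows "eval_poly (Cmon m) (act T z)
    = Cchar m (\<lambda>(i, j). sfac T z i / sfac T z j) * eval_poly (Cmon m) z"
proof -
  have "(\<lambda>(i, j). eval_poly (C i j) (act T z))
      = (\<lambda>x. (\<lambda>(i, j). sfac T z i / sfac T z j) x * (\<lambda>(i, j). eval_poly (C i j) z) x)"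
    by (simp add: fun_eq_iff C_act[OF assms])
  then show ?thesis by (simp only: eval_poly_Cmon Cchar_mult)
qed

lemma balanced_Cmon_A3:
  assumes "balanced m"
  shows "Cmon m \<in> A3"
  unfolding A3_def
proof (intro CollectI allI impI)
  fix T z assume T: "invertible T" "act_defined T z"
  have b: "m (1,2) + m (1,3) = m (2,1) + m (3,1)" "m (2,1) + m (2,3) = m (1,2) + m (3,2)"
    "m (1,3) + m (2,3) = m (3,1) + m (3,2)"
    using assms by (simp_all add: balanced_def)
  have "Cchar m (\<lambda>(i, j). sfac T z i / sfac T z j) = 1"
    unfolding Cchar_quotient b using T(2) by (simp add: act_defined_def)
  then show "eval_poly (Cmon m) (act T z) = eval_poly (Cmon m) z"
    by (simp add: Cmon_act[OF T])
qed

text \<open>Rescaling the homogeneous vectors of the base points by \<open>s\<close> fixes the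
  points projectively, while the factors \<open>sfac\<close> become arbitrary nonzero
  numbers.\<close>

lemma torus_element:
  fixes s :: "3 \<Rightarrow> real"
  assumes "\<And>i. s i \<noteq> 0"
  obtains T where "invertible T" "\<And>c. act_defined T (slice c)" "\<And>c i. sfac T (slice c) i = s i"
proof -
  let ?N = "\<chi> i. s i *\<^sub>R (base_mat $ i)"
  have "det ?N \<noteq> 0" using assms by (simp add: det_scale_rows)
  moreover have "det base_mat \<noteq> 0" by simp
  ultimately obtain T where T: "invertible T" "\<And>i. T *v (base_mat $ i) = ?N $ i"
    using ex_T_on_points by blast
  have "sfac T (slice c) i = s i" for c i
    using T(2)[of i] by (simp add: sfac_def pt_slice base_mat_def base_pt_def)
  moreover from this have "act_defined T (slice c)" for c
    using assms by (simp add: act_defined_def)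
  ultimately show ?thesis using that T(1) by blast
qed

text \<open>Comparing \<open>H\<close> at a slice point and at its torus translate gives a linear
  relation between characters. Independence then forces every monomial with nonzero coefficient to
  have trivial torus weight.\<close>

lemma A3_Cpoly_balanced:
  assumes H: "H \<in> A3" "H \<in> Cpoly"
  shows "H \<in> rpoly.span {Cmon m | m. balanced m}"
proof -
  obtain t r where t: "finite t" "t \<subseteq> range Cmon" and Ht: "H = (\<Sum>b\<in>t. Const (r b) * b)"
    using H(2) unfolding Cpoly_def rpoly.span_explicit by blast
  have "\<forall>b\<in>t. \<exists>m. b = Cmon m" using t(2) by blast
  then obtain m where m: "\<And>b. b \<in> t \<Longrightarrow> Cmon (m b) = b" by metis
  have key: "\<forall>b\<in>t. r b * (Cchar (m b) (\<lambda>(i, j). s i / s j) - 1) = 0"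
    if s: "\<And>i. s i \<noteq> 0" for s :: "3 \<Rightarrow> real"
  proof (rule characters_independent[where ch = "\<lambda>b. Cchar (m b)"])
    show "inj_on (\<lambda>b. Cchar (m b)) t"
    proof (rule inj_onI)
      fix b b' assume "b \<in> t" "b' \<in> t" "Cchar (m b) = Cchar (m b')"
      then show "b = b'" by (intro eval_poly_inject) (metis eval_poly_Cmon m)
    qed
    fix c :: "3 \<times> 3 \<Rightarrow> real"
    obtain T where T: "invertible T" "\<And>c. act_defined T (slice c)" "\<And>c i. sfac T (slice c) i = s i"
      using torus_element s by blast
    \<comment> \<open>On the slice the \<open>C i j\<close> attain arbitrary off-diagonal values, so
      the relation is obtained for every \<open>c\<close>. The diagonal is set to 0 because
      \<open>C_slice\<close> requires it.\<close>
    define z where "z = slice (\<lambda>(i, j). if i = j then 0 else c (i, j))"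
    have "eval_poly (C i j) z = (if i = j then 0 else c (i, j))" for i j
      unfolding z_def by (subst C_slice) auto
    then have "eval_poly (Cmon k) z = Cchar k c" for k
      unfolding eval_poly_Cmon by (simp add: Cchar_def prod_offdiag)
    then have b: "eval_poly b z = Cchar (m b) c" if "b \<in> t" for b
      using m[OF that] by metis
    have b': "eval_poly b (act T z) = Cchar (m b) (\<lambda>(i, j). s i / s j) * Cchar (m b) c" if "b \<in> t" for b
      using Cmon_act[OF T(1), of z "m b"] m[OF that] b[OF that] T(2,3) by (simp add: z_def)
    have "eval_poly H (act T z) - eval_poly H z = 0"
      using H(1) T(1,2) by (simp add: A3_def z_def)
    then show "(\<Sum>b\<in>t. r b * (Cchar (m b) (\<lambda>(i, j). s i / s j) - 1) * Cchar (m b) c) = 0"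
      unfolding Ht by (simp add: sum_subtractf[symmetric] b b' algebra_simps)
  qed (simp_all add: t(1) Cchar_mult, simp add: Cchar_def)
  have "balanced (m b)" if b: "b \<in> t" "r b \<noteq> 0" for b
  proof -
    \<comment> \<open>With factor 2 at \<open>k\<close> and 1 elsewhere, the weight is a quotient of
      powers of 2 whose triviality is balance at \<open>k\<close>.\<close>
    have "Cchar (m b) (\<lambda>(i, j). (if i = k then 2 else 1) / (if j = k then 2 else 1)) = 1" for k :: 3
    proof -
      define \<sigma> :: "3 \<Rightarrow> real" where "\<sigma> = (\<lambda>i. if i = k then 2 else 1)"
      have "\<sigma> i \<noteq> 0" for i by (simp add: \<sigma>_def)
      from bspec[OF key[of \<sigma>, OF this] b(1)] b(2)
      have "Cchar (m b) (\<lambda>(i, j). \<sigma> i / \<sigma> j) = 1" by simp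
      then show ?thesis by (simp only: \<sigma>_def)
    qed
    from this[of 1] this[of 2] show ?thesis
      unfolding Cchar_quotient[of "m b" "\<lambda>i. if i = _ then 2 else 1"] balanced_def by simp
  qed
  then have "b \<in> {Cmon m | m. balanced m}" if "b \<in> t" "r b \<noteq> 0" for b
    using m that by force
  then have "Const (r b) * b \<in> rpoly.span {Cmon m | m. balanced m}" if "b \<in> t" for b
    using that by (cases "r b = 0") (auto intro: rpoly.span_zero rpoly.span_scale rpoly.span_base)
  then show ?thesis unfolding Ht by (intro rpoly.span_sum)
qed

section \<open>Divisibility by the determinant of the covectors\<close>

abbreviation "c12 \<equiv> C 1 2 * C 2 1"
abbreviation "c23 \<equiv> C 2 3 * C 3 2"
abbreviation "c13 \<equiv> C 1 3 * C 3 1"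
abbreviation "cyc \<equiv> C 1 2 * C 2 3 * C 3 1"
abbreviation "cyc' \<equiv> C 1 3 * C 2 1 * C 3 2"

text \<open>The algebra generated by the five basic balanced products. Multiplication by one
  generator at a time gives the induction in \<open>bal_alg_decompose\<close> its cases.\<close>

inductive_set bal_alg where
  Const: "Const c \<in> bal_alg"
| add: "F \<in> bal_alg \<Longrightarrow> G \<in> bal_alg \<Longrightarrow> F + G \<in> bal_alg"
| mult: "g \<in> {c12, c23, c13, cyc, cyc'} \<Longrightarrow> F \<in> bal_alg \<Longrightarrow> g * F \<in> bal_alg"

lemma bal_alg_power: "g \<in> {c12, c23, c13, cyc, cyc'} \<Longrightarrow> F \<in> bal_alg \<Longrightarrow> g ^ n * F \<in> bal_alg"
proof (induction n)
  case (Suc n)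
  then have "g * (g ^ n * F) \<in> bal_alg" using bal_alg.mult by blast
  then show ?case by (simp add: mult.assoc)
qed simp

lemma bal_alg_scale: "F \<in> bal_alg \<Longrightarrow> Const c * F \<in> bal_alg"
proof (induction rule: bal_alg.induct)
  case (Const d)
  then show ?case using bal_alg.Const[of "c * d"] by (simp add: Const_mult)
next
  case (add F G)
  then show ?case by (simp add: distrib_left bal_alg.add)
next
  case (mult g F)
  then have "g * (Const c * F) \<in> bal_alg" using bal_alg.mult by blast
  then show ?case by (simp only: mult.left_commute)
qed

lemma bal_alg_uminus: "F \<in> bal_alg \<Longrightarrow> - F \<in> bal_alg"
proof -
  assume "F \<in> bal_alg"
  then have "Const (-1) * F \<in> bal_alg" by (rule bal_alg_scale)
  moreover have "Const (-1) * F = - F" by (rule eval_poly_inject) simp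
  ultimately show ?thesis by simp
qed

text \<open>Read as a flow on three vertices, a balanced exponent has the same excess
  \<open>d\<close> along all three edges of a cycle. Pairing opposite edges off leaves
  \<open>d\<close> copies of \<open>cyc\<close> or of \<open>cyc'\<close>, depending on the
  orientation.\<close>

lemma balanced_Cmon_bal_alg:
  assumes "balanced m"
  shows "Cmon m \<in> bal_alg"
proof -
  have one: "1 \<in> bal_alg" using bal_alg.Const[of 1] by simp
  have e: "Cmon m = C 1 2 ^ m (1,2) * C 1 3 ^ m (1,3) * C 2 1 ^ m (2,1) * C 2 3 ^ m (2,3)
      * C 3 1 ^ m (3,1) * C 3 2 ^ m (3,2)"
    unfolding Cmon_def prod_offdiag by simp
  show ?thesis
  proof (cases "m (2,1) \<le> m (1,2)")
    case True
    then obtain d where d: "m (1,2) = m (2,1) + d" using le_Suc_ex by blast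
    then have "m (3,1) = m (1,3) + d" "m (2,3) = m (3,2) + d"
      using assms by (simp_all add: balanced_def)
    with d e have "Cmon m = c12 ^ m (2,1) * (c23 ^ m (3,2) * (c13 ^ m (1,3) * (cyc ^ d * 1)))"
      by (simp only: power_add power_mult_distrib mult_ac mult_1)
    moreover have "c12 ^ m (2,1) * (c23 ^ m (3,2) * (c13 ^ m (1,3) * (cyc ^ d * 1))) \<in> bal_alg"
      by (intro bal_alg_power one) simp_all
    ultimately show ?thesis by simp
  next
    case False
    then obtain d where d: "m (2,1) = m (1,2) + d" by (metis le_Suc_ex nat_le_linear)
    then have "m (1,3) = m (3,1) + d" "m (3,2) = m (2,3) + d"
      using assms by (simp_all add: balanced_def)
    with d e have "Cmon m = c12 ^ m (1,2) * (c23 ^ m (2,3) * (c13 ^ m (3,1) * (cyc' ^ d * 1)))"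
      by (simp only: power_add power_mult_distrib mult_ac mult_1)
    moreover have "c12 ^ m (1,2) * (c23 ^ m (2,3) * (c13 ^ m (3,1) * (cyc' ^ d * 1))) \<in> bal_alg"
      by (intro bal_alg_power one) simp_all
    ultimately show ?thesis by simp
  qed
qed

lemma span_balanced_subset_bal_alg: "rpoly.span {Cmon m | m. balanced m} \<subseteq> bal_alg"
proof
  fix F assume "F \<in> rpoly.span {Cmon m | m. balanced m}"
  then show "F \<in> bal_alg"
  proof (induction rule: rpoly.span_induct_alt)
    case base
    then show ?case using bal_alg.Const[of 0] by simp
  next
    case (step c x y)
    then show ?case by (auto intro!: bal_alg.add bal_alg_scale balanced_Cmon_bal_alg)
  qed
qed

lemma bal_alg_subset_A3: "bal_alg \<subseteq> A3"
proof
  fix F assume "F \<in> bal_alg"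
  then show "F \<in> A3"
  proof (induction rule: bal_alg.induct)
    case (Const c)
    then show ?case by (rule A3_Const)
  next
    case (add F G)
    then show ?case by (simp add: A3_add)
  next
    case (mult g F)
    have "g \<in> A3"
      unfolding A3_def
    proof (intro CollectI allI impI)
      fix T z assume T: "invertible T" "act_defined T z"
      then have "sfac T z i \<noteq> 0" for i by (simp add: act_defined_def)
      with mult.hyps(1) show "eval_poly g (act T z) = eval_poly g z"
        by (auto simp: C_act[OF T] field_simps)
    qed
    then show ?case using mult by (simp add: A3_mult)
  qed
qed

text \<open>A semantic stand-in for being a polynomial in \<open>c12\<close>, \<open>c23\<close>, \<open>c13\<close>.\<close>

definition pair_only :: "rpoly \<Rightarrow> bool" where
  "pair_only F \<longleftrightarrow> (\<forall>z z'. eval_poly c12 z = eval_poly c12 z' \<longrightarrow> eval_poly c23 z = eval_poly c23 z' \<longrightarrow>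
     eval_poly c13 z = eval_poly c13 z' \<longrightarrow> eval_poly F z = eval_poly F z')"

lemma pair_only_intros:
  "pair_only (Const c)" "pair_only F \<Longrightarrow> pair_only G \<Longrightarrow> pair_only (F + G)"
  "pair_only F \<Longrightarrow> pair_only (- F)"
  "pair_only F \<Longrightarrow> pair_only G \<Longrightarrow> pair_only (F * G)"
  "pair_only c12" "pair_only c23" "pair_only c13"
  unfolding pair_only_def eval_poly_add eval_poly_uminus eval_poly_mult[of F G] eval_poly_Const by metis+

text \<open>Division by \<open>cyc + cyc'\<close>: modulo this element \<open>cyc'\<close> is
  \<open>- cyc\<close>, and \<open>cyc\<close> satisfies a quadratic equation over the pair
  products, so remainders are linear in \<open>cyc\<close>.\<close>

lemma bal_alg_decompose:
  assumes "G \<in> bal_alg"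
  obtains \<alpha> \<beta> G' where "G = \<alpha> + \<beta> * cyc + (cyc + cyc') * G'" "\<alpha> \<in> bal_alg" "\<beta> \<in> bal_alg" "G' \<in> bal_alg"
    "pair_only \<alpha>" "pair_only \<beta>"
proof -
  have zero: "0 \<in> bal_alg" "pair_only 0" using bal_alg.Const[of 0] pair_only_intros(1)[of 0] by simp_all
  have "\<exists>\<alpha> \<beta> G'. G = \<alpha> + \<beta> * cyc + (cyc + cyc') * G' \<and> \<alpha> \<in> bal_alg \<and> \<beta> \<in> bal_alg \<and> G' \<in> bal_alg
    \<and> pair_only \<alpha> \<and> pair_only \<beta>"
    using assms
  proof (induction rule: bal_alg.induct)
    case (Const c)
    have "Const c = Const c + 0 * cyc + (cyc + cyc') * 0" by simp
    then show ?case using zero bal_alg.Const pair_only_intros(1) by blast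
  next
    case (add F G)
    then obtain \<alpha> \<beta> G' \<alpha>' \<beta>' G'' where
      "F = \<alpha> + \<beta> * cyc + (cyc + cyc') * G'" "G = \<alpha>' + \<beta>' * cyc + (cyc + cyc') * G''"
      and *: "\<alpha> \<in> bal_alg" "\<beta> \<in> bal_alg" "G' \<in> bal_alg" "\<alpha>' \<in> bal_alg" "\<beta>' \<in> bal_alg" "G'' \<in> bal_alg"
      "pair_only \<alpha>" "pair_only \<beta>" "pair_only \<alpha>'" "pair_only \<beta>'"
      by blast
    then have "F + G = (\<alpha> + \<alpha>') + (\<beta> + \<beta>') * cyc + (cyc + cyc') * (G' + G'')"
      by (simp add: algebra_simps)
    then show ?case using * bal_alg.add pair_only_intros(2) by blast
  next
    case (mult g F)
    then obtain \<alpha> \<beta> G' where F: "F = \<alpha> + \<beta> * cyc + (cyc + cyc') * G'"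
      and *: "\<alpha> \<in> bal_alg" "\<beta> \<in> bal_alg" "G' \<in> bal_alg" "pair_only \<alpha>" "pair_only \<beta>"
      by blast
    \<comment> \<open>This is \<open>cyc * cyc' * \<beta>\<close>, rewritten through the pair
      products.\<close>
    let ?n = "c12 * (c23 * (c13 * \<beta>))"
    have n: "?n \<in> bal_alg" using *(2) by (intro bal_alg.mult) simp_all
    have np: "pair_only ?n" by (intro pair_only_intros *)
    consider "g \<in> {c12, c23, c13}" | "g = cyc" | "g = cyc'" using mult.hyps by blast
    then show ?case
    proof cases
      case 1
      then have "g * \<alpha> \<in> bal_alg" "g * \<beta> \<in> bal_alg" "g * G' \<in> bal_alg" using *(1-3) by (auto intro!: bal_alg.mult)
      moreover have "pair_only g" using 1 pair_only_intros(5-7) by blast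
      then have "pair_only (g * \<alpha>)" "pair_only (g * \<beta>)" using *(4,5) pair_only_intros(4) by blast+
      moreover have "g * F = g * \<alpha> + g * \<beta> * cyc + (cyc + cyc') * (g * G')"
        unfolding F by (simp add: algebra_simps)
      ultimately show ?thesis by blast
    next
      case 2
      \<comment> \<open>Uses \<open>cyc * cyc = cyc * (cyc + cyc') - cyc * cyc'\<close> on the term
        with \<open>\<beta>\<close>.\<close>
      have "g * F = - ?n + \<alpha> * cyc + (cyc + cyc') * (\<beta> * cyc + cyc * G')"
        unfolding F 2 by (simp add: algebra_simps)
      moreover have "cyc * \<beta> + cyc * G' \<in> bal_alg" using *(2,3) by (intro bal_alg.add bal_alg.mult) simp_all
      then have "\<beta> * cyc + cyc * G' \<in> bal_alg" by (simp only: mult.commute)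
      ultimately show ?thesis using * n np bal_alg_uminus pair_only_intros(3) by blast
    next
      case 3
      \<comment> \<open>Uses \<open>cyc' = (cyc + cyc') - cyc\<close> on the term with
        \<open>\<alpha>\<close>.\<close>
      have "g * F = ?n + (- \<alpha>) * cyc + (cyc + cyc') * (\<alpha> + cyc' * G')"
        unfolding F 3 by (simp add: algebra_simps)
      moreover have "\<alpha> + cyc' * G' \<in> bal_alg" using *(1,3) by (intro bal_alg.add bal_alg.mult) simp_all
      ultimately show ?thesis using * n np bal_alg_uminus pair_only_intros(3) by blast
    qed
  qed
  then show ?thesis using that by blast
qed

section \<open>Collinear configurations and division by \<open>D123\<close>\<close>

text \<open>Three points on the line \<open>y = 0\<close>: there the \<open>C i j\<close> do not involve the \<open>VQ\<close>-coordinates,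
  which are chosen so that \<open>D123\<close> does not vanish.\<close>

definition collinear_config :: "real \<Rightarrow> real \<Rightarrow> real \<Rightarrow> var \<Rightarrow> real" where
  "collinear_config p1 p2 p3 v = (case v of VX i \<Rightarrow> if i = 1 then 0 else if i = 2 then 1 else 2
     | VY i \<Rightarrow> 0
     | VP i \<Rightarrow> if i = 1 then p1 else if i = 2 then p2 else p3
     | VQ i \<Rightarrow> if i = 1 then 1 else 0)"

lemma eval_collinear_config:
  "eval_poly c12 (collinear_config p1 p2 p3) = - p1 * p2"
  "eval_poly c23 (collinear_config p1 p2 p3) = - p2 * p3"
  "eval_poly c13 (collinear_config p1 p2 p3) = - 4 * p1 * p3"
  "eval_poly cyc (collinear_config p1 p2 p3) = - 2 * p1 * p2 * p3"
  "eval_poly detA (collinear_config p1 p2 p3) = 0"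
  "eval_poly D123 (collinear_config p1 p2 p3) = p2 * p3"
  by (simp_all add: eval_poly_C_coords collinear_config_def eval_poly_detA eval_poly_D123 det_3 pt_def ell_def)

text \<open>The three equations force \<open>p1 * p1 = - (a * c) / (4 * b)\<close>, which is
  positive because \<open>a * b * c\<close> is negative; \<open>p2\<close> and \<open>p3\<close>
  follow by division.\<close>

lemma collinear_config_exists:
  fixes a b c :: real
  assumes "a * b * c < 0"
  obtains p1 p2 p3 where "a = - p1 * p2" "b = - p2 * p3" "c = - 4 * p1 * p3" "p1 \<noteq> 0" "p2 \<noteq> 0" "p3 \<noteq> 0"
proof -
  have nz: "a \<noteq> 0" "b \<noteq> 0" "c \<noteq> 0" using assms by auto
  have "- (a * c) / (4 * b) = - (a * b * c) / (4 * b\<^sup>2)"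
    using nz by (simp add: field_simps power2_eq_square)
  also have "\<dots> > 0" using assms nz by (intro divide_pos_pos) auto
  finally have pos: "- (a * c) / (4 * b) > 0" .
  define p1 where "p1 = sqrt (- (a * c) / (4 * b))"
  have p1: "p1 * p1 = - (a * c) / (4 * b)" "p1 \<noteq> 0"
    using pos unfolding p1_def real_sqrt_mult_self by (simp_all only: abs_of_pos real_sqrt_eq_0_iff)
  show ?thesis
  proof (rule that[of p1 "- a / p1" "- c / (4 * p1)"])
    have "- (- a / p1) * (- c / (4 * p1)) = - (a * c) / (4 * (p1 * p1))"
      by simp
    then show "b = - (- a / p1) * (- c / (4 * p1))"
      unfolding p1(1) using nz by simp
  qed (use nz p1(2) in auto)
qed

text \<open>On a collinear configuration \<open>detA\<close> and \<open>cyc + cyc'\<close> vanish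
  while \<open>D123\<close> does not, so \<open>\<alpha> + \<beta> * cyc\<close> vanishes. Negating
  all \<open>p\<close> keeps the pair products and flips \<open>cyc\<close>, which separates
  \<open>\<alpha>\<close> from \<open>\<beta>\<close>; density does the rest.\<close>

lemma collinear_vanishing:
  assumes eq: "detA * X = D123 ^ k * (\<alpha> + \<beta> * cyc + (cyc + cyc') * G')"
    and "pair_only \<alpha>" "pair_only \<beta>"
  shows "\<alpha> = 0 \<and> \<beta> = 0"
proof -
  have *: "eval_poly \<alpha> z = 0 \<and> eval_poly \<beta> z = 0" if neg: "eval_poly (c12 * c23 * c13) z < 0" for z
  proof -
    have "eval_poly c12 z * eval_poly c23 z * eval_poly c13 z < 0"
      using neg by (simp only: eval_poly_mult)
    then obtain p1 p2 p3 where p: "eval_poly c12 z = - p1 * p2" "eval_poly c23 z = - p2 * p3"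
      "eval_poly c13 z = - 4 * p1 * p3" "p1 \<noteq> 0" "p2 \<noteq> 0" "p3 \<noteq> 0"
      using collinear_config_exists by blast
    \<comment> \<open>The sign \<open>e\<close> is 1 or -1. The point \<open>z\<close> itself may be
      noncollinear: \<open>pair_only\<close> moves the values of \<open>\<alpha>\<close> and
      \<open>\<beta>\<close> to the collinear configuration with the same pair products.\<close>
    have v: "eval_poly \<alpha> z + eval_poly \<beta> z * (- 2 * (e * p1) * (e * p2) * (e * p3)) = 0"
      if e: "e * e = 1" for e
    proof -
      let ?y = "collinear_config (e * p1) (e * p2) (e * p3)"
      have e0: "e \<noteq> 0" using e by auto
      have ee: "e * x * (e * y) = x * y" for x y
        using e by (metis mult.assoc mult.left_commute mult_1)
      have "eval_poly c12 z = eval_poly c12 ?y" "eval_poly c23 z = eval_poly c23 ?y"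
        "eval_poly c13 z = eval_poly c13 ?y"
        unfolding eval_collinear_config p using ee[of p1 p2] ee[of p2 p3] ee[of p1 p3] by (simp_all add: mult.assoc)
      then have same: "eval_poly \<alpha> z = eval_poly \<alpha> ?y" "eval_poly \<beta> z = eval_poly \<beta> ?y"
        using assms(2,3) unfolding pair_only_def by blast+
      have E: "eval_poly (cyc + cyc') ?y = 0"
        unfolding D123_mult_detA[symmetric] eval_poly_mult eval_collinear_config by simp
      have "0 = eval_poly (D123 ^ k * (\<alpha> + \<beta> * cyc + (cyc + cyc') * G')) ?y"
        unfolding eq[symmetric] eval_poly_mult[of detA] eval_collinear_config by simp
      also have "\<dots> = eval_poly D123 ?y ^ k * (eval_poly \<alpha> ?y + eval_poly \<beta> ?y * eval_poly cyc ?y)"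
        unfolding eval_poly_mult[of "D123 ^ k"] eval_poly_mult[of "cyc + cyc'"] eval_poly_mult[of \<beta>]
          eval_poly_add[of _ "(cyc + cyc') * G'"] eval_poly_add[of \<alpha>] E by simp
      finally show ?thesis
        unfolding eval_collinear_config same using p e0 by simp
    qed
    have "eval_poly \<alpha> z = 0" "eval_poly \<beta> z * (p1 * p2 * p3) = 0"
      using v[of 1] v[of "-1"] by (simp_all add: algebra_simps)
    then show ?thesis using p by simp
  qed
  have neg: "eval_poly (c12 * c23 * c13) (collinear_config 1 1 1) < 0"
    unfolding eval_poly_mult[of _ c13] eval_poly_mult[of c12] eval_collinear_config by simp
  show ?thesis
    using eval_poly_eq_0_if_vanishing[OF neg, of \<alpha>] eval_poly_eq_0_if_vanishing[OF neg, of \<beta>] * by blast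
qed

text \<open>Each step exchanges one factor \<open>detA\<close> on the left for one factor
  \<open>D123\<close> on the right, since only the multiple of
  \<open>cyc + cyc' = D123 * detA\<close> survives. The exponent \<open>k\<close> accumulates the
  factors already gained.\<close>

lemma D123_divides:
  assumes "detA ^ n * F = D123 ^ k * G" "G \<in> bal_alg"
  shows "\<exists>G'\<in>bal_alg. F = D123 ^ (k + n) * G'"
  using assms
proof (induction n arbitrary: k G)
  case 0
  then show ?case by auto
next
  case (Suc n)
  obtain \<alpha> \<beta> G' where G: "G = \<alpha> + \<beta> * cyc + (cyc + cyc') * G'" "G' \<in> bal_alg"
    "pair_only \<alpha>" "pair_only \<beta>"
    using bal_alg_decompose[OF Suc.prems(2)] by metis
  have eq: "detA * (detA ^ n * F) = D123 ^ k * (\<alpha> + \<beta> * cyc + (cyc + cyc') * G')"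
    using Suc.prems(1) by (simp only: G(1) power_Suc mult.assoc)
  have "\<alpha> = 0" "\<beta> = 0" using collinear_vanishing[OF eq G(3,4)] by auto
  then have "detA * (detA ^ n * F) = D123 ^ k * ((D123 * detA) * G')"
    unfolding eq D123_mult_detA by simp
  then have "detA * (detA ^ n * F) = detA * (D123 ^ Suc k * G')"
    by (simp add: mult_ac)
  then have "detA ^ n * F = D123 ^ Suc k * G'" by (rule rpoly_mult_cancel[OF detA_nonzero])
  from Suc.IH[OF this G(2)] show ?case by simp
qed

section \<open>Structure of the spaces of relative invariants\<close>

lemma A3_eq_span_balanced: "A3 = rpoly.span {Cmon m | m. balanced m}"
proof
  show "A3 \<subseteq> rpoly.span {Cmon m | m. balanced m}"
  proof
    fix F assume F: "F \<in> A3"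
    then have "F \<in> Cpoly" using detA_power_mult_Cpoly[of F 0] by (simp add: A3_eq_rel_inv)
    then show "F \<in> rpoly.span {Cmon m | m. balanced m}" using F A3_Cpoly_balanced by blast
  qed
  show "rpoly.span {Cmon m | m. balanced m} \<subseteq> A3"
    using span_balanced_subset_bal_alg bal_alg_subset_A3 by blast
qed

lemma rel_inv_eq: "rel_inv w = (\<lambda>F. D123 ^ w * F) ` A3"
proof
  show "rel_inv w \<subseteq> (\<lambda>F. D123 ^ w * F) ` A3"
  proof
    fix F assume F: "F \<in> rel_inv w"
    have "detA ^ w * F \<in> bal_alg"
      using A3_Cpoly_balanced[OF detA_power_mult_A3[OF F] detA_power_mult_Cpoly[OF F]] span_balanced_subset_bal_alg
      by blast
    then obtain G where "G \<in> bal_alg" "F = D123 ^ w * G" using D123_divides[of w F 0] by auto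
    then show "F \<in> (\<lambda>F. D123 ^ w * F) ` A3" using bal_alg_subset_A3 by blast
  qed
  show "(\<lambda>F. D123 ^ w * F) ` A3 \<subseteq> rel_inv w"
    using rel_inv_mult[OF D123_power_rel_inv, of _ 0 w] by (auto simp: A3_eq_rel_inv)
qed

lemma P3m1_eq: "P3m1 = (\<lambda>F. D123 ^ 3 * F) ` A3"
  by (simp add: P3m1_eq_rel_inv rel_inv_eq)

section \<open>The graded quotient\<close>

lemma D123_power_nonzero: "D123 ^ n \<noteq> 0"
proof
  assume "D123 ^ n = 0"
  then have "eval_poly (D123 ^ n) (collinear_config 1 1 1) = 0" by simp
  then show False unfolding eval_poly_power eval_collinear_config by simp
qed

text \<open>Evaluation at the origin thus reads off the component of C-degree 0 of an element of
  \<open>A3\<close>.\<close>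

lemma eval_poly_C_0 [simp]: "eval_poly (C i j) (\<lambda>_. 0) = 0"
  by (simp add: eval_poly_C_coords)

lemma Cdeg_eq_0_iff: "Cdeg m = 0 \<longleftrightarrow> (\<forall>x\<in>offdiag. m x = 0)"
  unfolding Cdeg_def by (rule sum_eq_0_iff) simp

lemma Cmon_Cdeg_0: "Cdeg m = 0 \<Longrightarrow> Cmon m = 1"
  unfolding Cdeg_eq_0_iff Cmon_def by (rule prod.neutral) auto

lemma eval_poly_Cmon_0:
  assumes "Cdeg m \<noteq> 0"
  shows "eval_poly (Cmon m) (\<lambda>_. 0) = 0"
proof -
  obtain x where x: "x \<in> offdiag" "m x \<noteq> 0" 
    using assms unfolding Cdeg_def by (rule sum.not_neutral_contains_not_neutral)
  have "(case x of (i, j) \<Rightarrow> eval_poly (C i j) (\<lambda>_. 0)) ^ m x = 0"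
    using x(2) by (simp add: split_def zero_power)
  then show ?thesis
    unfolding eval_poly_Cmon Cchar_def by (intro prod_zero bexI[OF _ x(1)]) simp_all
qed

lemma A3_plus_sub: "A3_plus \<subseteq> {G \<in> A3. eval_poly G (\<lambda>_. 0) = 0}" (is "_ \<subseteq> ?S")
proof -
  have S: "rpoly.subspace ?S"
    using subspace_A3 by (auto simp: rpoly.subspace_def)
  have "A3_gr k \<subseteq> ?S" if "k > 0" for k
    unfolding A3_gr_def using that by (intro rpoly.span_minimal S) (auto simp: eval_poly_Cmon_0)
  then show ?thesis
    unfolding A3_plus_def by (intro rpoly.span_minimal S) auto
qed

text \<open>A balanced monomial is either 1 or has positive C-degree and vanishes at the origin.
  With \<open>A3_plus_sub\<close> this identifies \<open>A3_plus\<close> as the kernel of evaluation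
  at the origin.\<close>

lemma A3_minus_constant_term:
  assumes "G \<in> A3"
  shows "G - Const (eval_poly G (\<lambda>_. 0)) \<in> A3_plus"
  using assms unfolding A3_eq_span_balanced
proof (induction rule: rpoly.span_induct_alt)
  case base
  then show ?case by (simp add: A3_plus_def rpoly.span_zero)
next
  case (step c x y)
  then obtain m where m: "x = Cmon m" "balanced m" by auto
  let ?e = "\<lambda>G. eval_poly G (\<lambda>_. 0)"
  have "x - Const (?e x) \<in> A3_plus"
  proof (cases "Cdeg m = 0")
    case True
    then show ?thesis by (simp add: m(1) Cmon_Cdeg_0 A3_plus_def rpoly.span_zero)
  next
    case False
    have "x \<in> A3_gr (Cdeg m)"
      unfolding A3_gr_def m(1) using balanced_Cmon_A3[OF m(2)] by (auto intro!: rpoly.span_base)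
    then show ?thesis
      using False by (auto simp: m(1) eval_poly_Cmon_0 A3_plus_def intro!: rpoly.span_base)
  qed
  moreover have *: "Const c * x + y - Const (?e (Const c * x + y))
      = Const c * (x - Const (?e x)) + (y - Const (?e y))"
    by (simp add: Const_add Const_mult algebra_simps)
  ultimately show ?case
    using step.IH unfolding * A3_plus_def by (intro rpoly.span_add rpoly.span_scale)
qed

text \<open>The levels turn out to be the cosets that make up \<open>Q3\<close>, so that \<open>r \<mapsto> P3m1_level r\<close>
  is an isomorphism from the reals to \<open>Q3\<close>.\<close>

definition P3m1_level :: "real \<Rightarrow> rpoly set" where
  "P3m1_level r = {D123 ^ 3 * G | G. G \<in> A3 \<and> eval_poly G (\<lambda>_. 0) = r}"

lemma D123_cube_mult_in_level_iff:
  "D123 ^ 3 * G \<in> P3m1_level r \<longleftrightarrow> G \<in> A3 \<and> eval_poly G (\<lambda>_. 0) = r"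
  unfolding P3m1_level_def using rpoly_mult_cancel[OF D123_power_nonzero] by blast

lemma P3m1_level_inject: "P3m1_level r = P3m1_level s \<longleftrightarrow> r = s"
  using D123_cube_mult_in_level_iff[of "Const r"] by (metis A3_Const eval_poly_Const)

text \<open>The equivalence also covers differences, which is how cosets and sums of levels are
  computed below.\<close>

lemma P3m1_level_add:
  assumes "F \<in> P3m1_level r"
  shows "F + G \<in> P3m1_level (r + s) \<longleftrightarrow> G \<in> P3m1_level s"
proof -
  obtain f where f: "F = D123 ^ 3 * f" "f \<in> A3" "eval_poly f (\<lambda>_. 0) = r"
    using assms by (auto simp: P3m1_level_def)
  show ?thesis
  proof
    assume "G \<in> P3m1_level s"
    then obtain g where g: "G = D123 ^ 3 * g" "g \<in> A3" "eval_poly g (\<lambda>_. 0) = s"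
      by (auto simp: P3m1_level_def)
    have "F + G = D123 ^ 3 * (f + g)" by (simp add: f g distrib_left)
    then show "F + G \<in> P3m1_level (r + s)"
      using f g by (simp only: D123_cube_mult_in_level_iff) (simp add: A3_add)
  next
    assume "F + G \<in> P3m1_level (r + s)"
    then obtain h where h: "F + G = D123 ^ 3 * h" "h \<in> A3" "eval_poly h (\<lambda>_. 0) = r + s"
      by (auto simp: P3m1_level_def)
    have "G = D123 ^ 3 * (h - f)" using h(1) by (simp add: f algebra_simps)
    then show "G \<in> P3m1_level s"
      using f h by (simp only: D123_cube_mult_in_level_iff) (simp add: rpoly.subspace_diff[OF subspace_A3])
  qed
qed

lemma P3m1_level_scale:
  assumes "F \<in> P3m1_level r"
  shows "Const c * F \<in> P3m1_level (c * r)"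
proof -
  obtain f where f: "F = D123 ^ 3 * f" "f \<in> A3" "eval_poly f (\<lambda>_. 0) = r"
    using assms by (auto simp: P3m1_level_def)
  have "Const c * F = D123 ^ 3 * (Const c * f)" by (simp add: f)
  then show ?thesis
    using f by (simp only: D123_cube_mult_in_level_iff) (simp add: A3_mult A3_Const)
qed

lemma P3m1_eq_Union_levels: "P3m1 = (\<Union>r. P3m1_level r)"
  unfolding P3m1_eq P3m1_level_def by auto

lemma P3m1_level_nonempty: "D123 ^ 3 * Const r \<in> P3m1_level r"
  by (simp add: D123_cube_mult_in_level_iff A3_Const)

lemma zero_in_P3m1_level: "0 \<in> P3m1_level 0"
  using P3m1_level_nonempty[of 0] by simp

lemma A3_plus_P3m1_eq: "A3_plus_P3m1 = P3m1_level 0"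
proof
  show "A3_plus_P3m1 \<subseteq> P3m1_level 0"
  proof
    fix F assume "F \<in> A3_plus_P3m1"
    then obtain n :: nat and a f where F: "F = (\<Sum>k<n. a k * f k)" "\<And>k. k < n \<Longrightarrow> a k \<in> A3_plus \<and> f k \<in> P3m1"
      unfolding A3_plus_P3m1_def by blast
    have "a k * f k \<in> P3m1_level 0" if k: "k < n" for k
    proof -
      obtain g where g: "f k = D123 ^ 3 * g" "g \<in> A3" using F(2)[OF k] unfolding P3m1_eq by blast
      have a: "a k \<in> A3" "eval_poly (a k) (\<lambda>_. 0) = 0" using A3_plus_sub F(2)[OF k] by auto
      have "a k * f k = D123 ^ 3 * (a k * g)" by (simp add: g mult.left_commute)
      then show ?thesis
        using a g by (simp only: D123_cube_mult_in_level_iff) (simp add: A3_mult)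
    qed
    then show "F \<in> P3m1_level 0"
      unfolding F(1)
    proof (induction n)
      case 0
      then show ?case by (simp add: zero_in_P3m1_level)
    next
      case (Suc n)
      then show ?case using P3m1_level_add[of _ 0 _ 0] by simp
    qed
  qed
  show "P3m1_level 0 \<subseteq> A3_plus_P3m1"
  proof
    fix F assume "F \<in> P3m1_level 0"
    then obtain G where G: "F = D123 ^ 3 * G" "G \<in> A3" "eval_poly G (\<lambda>_. 0) = 0"
      by (auto simp: P3m1_level_def)
    have "G \<in> A3_plus" using A3_minus_constant_term[OF G(2)] G(3) by simp
    moreover have "D123 ^ 3 * Const 1 \<in> P3m1"
      using P3m1_level_nonempty P3m1_eq_Union_levels by blast
    \<comment> \<open>A single term suffices, since \<open>D123 ^ 3\<close> generates the
      module.\<close>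
    moreover have "F = (\<Sum>k<1::nat. G * (D123 ^ 3 * Const 1))" by (simp add: G mult.commute)
    ultimately show "F \<in> A3_plus_P3m1"
      unfolding A3_plus_P3m1_def
      by (intro CollectI exI[of _ "1::nat"] exI[of _ "\<lambda>_. G"] exI[of _ "\<lambda>_. D123 ^ 3 * Const 1"]) simp
  qed
qed

lemma coset_eq_level:
  assumes "F \<in> P3m1_level r"
  shows "A3_plus_P3m1 +>\<^bsub>P3m1_space\<^esub> F = P3m1_level r"
proof -
  have "A3_plus_P3m1 +>\<^bsub>P3m1_space\<^esub> F = (\<lambda>h. h + F) ` P3m1_level 0"
    by (auto simp: a_r_coset_def' A3_plus_P3m1_eq P3m1_space_def)
  also have "\<dots> = P3m1_level r"
  proof
    show "(\<lambda>h. h + F) ` P3m1_level 0 \<subseteq> P3m1_level r"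
      using P3m1_level_add[of _ 0 F r] assms by auto
    show "P3m1_level r \<subseteq> (\<lambda>h. h + F) ` P3m1_level 0"
    proof
      fix H assume "H \<in> P3m1_level r"
      then have "H - F \<in> P3m1_level 0" using P3m1_level_add[OF assms, of "H - F" 0] by simp
      then show "H \<in> (\<lambda>h. h + F) ` P3m1_level 0" by (intro image_eqI[of _ _ "H - F"]) simp_all
    qed
  qed
  finally show ?thesis .
qed

lemma carrier_Q3: "carrier Q3 = range P3m1_level"
proof -
  have "carrier Q3 = (\<lambda>F. A3_plus_P3m1 +>\<^bsub>P3m1_space\<^esub> F) ` P3m1"
    by (auto simp: Q3_def quot_module_def A_RCOSETS_def' P3m1_space_def)
  also have "\<dots> = range P3m1_level"
    unfolding P3m1_eq_Union_levels
  proof safe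
    fix F r assume "F \<in> P3m1_level r"
    then show "A3_plus_P3m1 +>\<^bsub>P3m1_space\<^esub> F \<in> range P3m1_level" by (simp add: coset_eq_level)
  next
    fix r show "P3m1_level r \<in> (\<lambda>F. A3_plus_P3m1 +>\<^bsub>P3m1_space\<^esub> F) ` (\<Union>r. P3m1_level r)"
      using P3m1_level_nonempty[of r] coset_eq_level[of _ r] by blast
  qed
  finally show ?thesis .
qed

lemma zero_Q3: "\<zero>\<^bsub>Q3\<^esub> = P3m1_level 0"
  by (simp add: Q3_def quot_module_def A3_plus_P3m1_eq)

lemma add_Q3: "P3m1_level r \<oplus>\<^bsub>Q3\<^esub> P3m1_level s = P3m1_level (r + s)"
proof -
  have "P3m1_level r \<oplus>\<^bsub>Q3\<^esub> P3m1_level s = (\<Union>F\<in>P3m1_level r. \<Union>G\<in>P3m1_level s. {F + G})"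
    by (simp add: Q3_def quot_module_def set_add_def' P3m1_space_def)
  also have "\<dots> = P3m1_level (r + s)"
  proof
    show "(\<Union>F\<in>P3m1_level r. \<Union>G\<in>P3m1_level s. {F + G}) \<subseteq> P3m1_level (r + s)"
      using P3m1_level_add by auto
    show "P3m1_level (r + s) \<subseteq> (\<Union>F\<in>P3m1_level r. \<Union>G\<in>P3m1_level s. {F + G})"
    proof
      fix H assume "H \<in> P3m1_level (r + s)"
      \<comment> \<open>\<open>D123 ^ 3 * Const r\<close> serves as the standard representative of
        level \<open>r\<close>.\<close>
      then have "H - D123 ^ 3 * Const r \<in> P3m1_level s"
        using P3m1_level_add[OF P3m1_level_nonempty[of r], of "H - D123 ^ 3 * Const r" s] by simp
      moreover have "H = D123 ^ 3 * Const r + (H - D123 ^ 3 * Const r)" by simp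
      ultimately show "H \<in> (\<Union>F\<in>P3m1_level r. \<Union>G\<in>P3m1_level s. {F + G})"
        using P3m1_level_nonempty[of r] by blast
    qed
  qed
  finally show ?thesis .
qed

lemma smult_Q3: "c \<odot>\<^bsub>Q3\<^esub> P3m1_level r = P3m1_level (c * r)"
proof -
  have "c \<odot>\<^bsub>Q3\<^esub> P3m1_level r = (\<Union>F\<in>P3m1_level r. A3_plus_P3m1 +>\<^bsub>P3m1_space\<^esub> (Const c * F))"
    by (simp add: Q3_def quot_module_def) (simp add: P3m1_space_def)
  also have "\<dots> = (\<Union>F\<in>P3m1_level r. P3m1_level (c * r))"
    by (intro SUP_cong refl coset_eq_level P3m1_level_scale)
  also have "\<dots> = P3m1_level (c * r)" using P3m1_level_nonempty[of r] by blast
  finally show ?thesis .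
qed

section \<open>Freeness and dimension\<close>

lemma free_module_of_rank_1I:
  fixes R :: "('r, 'x) ring_scheme" and M :: "('r, 'm, 'y) module_scheme"
  assumes M: "Module.module R M" and b: "b \<in> carrier M"
    and basis: "\<And>x. x \<in> carrier M \<Longrightarrow> \<exists>!r. r \<in> carrier R \<and> x = r \<odot>\<^bsub>M\<^esub> b"
  shows "free_module_of_rank R M 1"
proof -
  interpret Module.module R M by (rule M)
  have fin: "(\<Oplus>\<^bsub>M\<^esub>b'\<in>{b}. c b' \<odot>\<^bsub>M\<^esub> b') = c b \<odot>\<^bsub>M\<^esub> b" if "c \<in> {b} \<rightarrow>\<^sub>E carrier R" for c
    using that b by (subst M.finsum_insert) (auto simp: PiE_iff)
  have "\<exists>!c. c \<in> {b} \<rightarrow>\<^sub>E carrier R \<and> x = (\<Oplus>\<^bsub>M\<^esub>b'\<in>{b}. c b' \<odot>\<^bsub>M\<^esub> b')" if x: "x \<in> carrier M" for x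
  proof -
    obtain r where r: "r \<in> carrier R" "x = r \<odot>\<^bsub>M\<^esub> b" "\<And>s. s \<in> carrier R \<Longrightarrow> x = s \<odot>\<^bsub>M\<^esub> b \<Longrightarrow> s = r"
      using basis[OF x] by blast
    \<comment> \<open>Coefficient families on a singleton correspond to scalars; restriction to
      \<open>{b}\<close> fixes the value outside, which uniqueness depends on.\<close>
    have c: "(\<lambda>_\<in>{b}. r) \<in> {b} \<rightarrow>\<^sub>E carrier R" using r(1) by auto
    show ?thesis
    proof (rule ex1I[of _ "\<lambda>_\<in>{b}. r"])
      show "(\<lambda>_\<in>{b}. r) \<in> {b} \<rightarrow>\<^sub>E carrier R \<and> x = (\<Oplus>\<^bsub>M\<^esub>b'\<in>{b}. (\<lambda>_\<in>{b}. r) b' \<odot>\<^bsub>M\<^esub> b')"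
        using c r(2) fin[OF c] by simp
      fix c assume c: "c \<in> {b} \<rightarrow>\<^sub>E carrier R \<and> x = (\<Oplus>\<^bsub>M\<^esub>b'\<in>{b}. c b' \<odot>\<^bsub>M\<^esub> b')"
      then have "c b = r" using fin[of c] r(3)[of "c b"] by (auto simp: PiE_iff)
      then show "c = (\<lambda>_\<in>{b}. r)"
        using c by (auto simp: fun_eq_iff PiE_def extensional_def)
    qed
  qed
  then have "module_basis R M {b}" using b by (simp add: module_basis_def)
  then show ?thesis using M by (auto simp: free_module_of_rank_def intro!: exI[of _ "{b}"])
qed

lemma cring_A3_ring: "cring A3_ring"
proof (rule cringI)
  show "abelian_group A3_ring"
  proof (rule abelian_groupI)
    fix x assume "x \<in> carrier A3_ring"
    then show "\<exists>y\<in>carrier A3_ring. y \<oplus>\<^bsub>A3_ring\<^esub> x = \<zero>\<^bsub>A3_ring\<^esub>"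
      using rpoly.subspace_neg[OF subspace_A3] by (intro bexI[of _ "- x"]) (simp_all add: A3_ring_def)
  qed (use A3_add A3_Const[of 0] in \<open>simp_all add: A3_ring_def algebra_simps\<close>)
  show "comm_monoid A3_ring"
    by (rule comm_monoidI) (use A3_mult A3_Const[of 1] in \<open>simp_all add: A3_ring_def algebra_simps\<close>)
qed (simp add: A3_ring_def distrib_right)

lemma module_P3m1: "Module.module A3_ring P3m1_module"
proof (rule moduleI)
  have S: "rpoly.subspace P3m1"
    by (rule rpoly.subspaceI) (simp_all add: P3m1_def algebra_simps)
  show "abelian_group P3m1_module"
  proof (rule abelian_groupI)
    fix x assume "x \<in> carrier P3m1_module"
    then show "\<exists>y\<in>carrier P3m1_module. y \<oplus>\<^bsub>P3m1_module\<^esub> x = \<zero>\<^bsub>P3m1_module\<^esub>"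
      using rpoly.subspace_neg[OF S] by (intro bexI[of _ "- x"]) (simp_all add: P3m1_module_def)
  qed (use rpoly.subspace_add[OF S] rpoly.subspace_0[OF S] in \<open>simp_all add: P3m1_module_def algebra_simps\<close>)
  show "a \<odot>\<^bsub>P3m1_module\<^esub> x \<in> carrier P3m1_module"
    if "a \<in> carrier A3_ring" "x \<in> carrier P3m1_module" for a x
    using that by (simp add: P3m1_module_def A3_ring_def P3m1_def A3_def)
qed (rule cring_A3_ring, simp_all add: P3m1_module_def A3_ring_def algebra_simps)

lemma P3m1_free: "free_module_of_rank A3_ring P3m1_module 1"
proof (rule free_module_of_rank_1I[OF module_P3m1])
  show "D123 ^ 3 \<in> carrier P3m1_module"
    using D123_power_rel_inv[of 3] by (simp add: P3m1_module_def P3m1_eq_rel_inv)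
  fix F assume "F \<in> carrier P3m1_module"
  then obtain G where "F = D123 ^ 3 * G" "G \<in> A3"
    by (auto simp: P3m1_module_def P3m1_eq)
  then show "\<exists>!G. G \<in> carrier A3_ring \<and> F = G \<odot>\<^bsub>P3m1_module\<^esub> D123 ^ 3"
    using rpoly_mult_cancel[OF D123_power_nonzero]
    by (intro ex1I[of _ G]) (auto simp: A3_ring_def P3m1_module_def mult.commute)
qed

lemma field_real_ring: "Ring.field real_ring"
proof (rule cring.cring_fieldI2)
  show "cring real_ring"
  proof (rule cringI)
    show "abelian_group real_ring"
    proof (rule abelian_groupI)
      fix x show "\<exists>y\<in>carrier real_ring. y \<oplus>\<^bsub>real_ring\<^esub> x = \<zero>\<^bsub>real_ring\<^esub>"
        by (intro bexI[of _ "- x"]) (simp_all add: real_ring_def)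
    qed (simp_all add: real_ring_def)
    show "comm_monoid real_ring"
      by (rule comm_monoidI) (simp_all add: real_ring_def)
  qed (simp add: real_ring_def distrib_right)
  fix a assume "a \<noteq> \<zero>\<^bsub>real_ring\<^esub>"
  then show "\<exists>b\<in>carrier real_ring. a \<otimes>\<^bsub>real_ring\<^esub> b = \<one>\<^bsub>real_ring\<^esub>"
    by (intro bexI[of _ "inverse a"]) (simp_all add: real_ring_def)
qed (simp add: real_ring_def)

lemma module_Q3: "Module.module real_ring Q3"
proof (rule moduleI)
  show "cring real_ring" using field_real_ring by (simp add: field_def domain_def)
  show "abelian_group Q3"
  proof (rule abelian_groupI)
    fix x assume "x \<in> carrier Q3"
    then obtain r where "x = P3m1_level r" by (auto simp: carrier_Q3)
    then show "\<exists>y\<in>carrier Q3. y \<oplus>\<^bsub>Q3\<^esub> x = \<zero>\<^bsub>Q3\<^esub>"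
      by (intro bexI[of _ "P3m1_level (- r)"]) (simp_all add: carrier_Q3 add_Q3 zero_Q3)
  qed (auto simp: carrier_Q3 add_Q3 zero_Q3 add_ac)
qed (auto simp: carrier_Q3 add_Q3 smult_Q3 real_ring_def algebra_simps)

lemma Q3_dimension: "has_dimension real_ring Q3 1"
  unfolding has_dimension_def
proof (intro conjI field_real_ring free_module_of_rank_1I[OF module_Q3])
  show "P3m1_level 1 \<in> carrier Q3" by (simp add: carrier_Q3)
  fix x assume "x \<in> carrier Q3"
  then obtain r where "x = P3m1_level r" by (auto simp: carrier_Q3)
  then show "\<exists>!c. c \<in> carrier real_ring \<and> x = c \<odot>\<^bsub>Q3\<^esub> P3m1_level 1"
    by (simp add: smult_Q3 P3m1_level_inject real_ring_def)
qed

text \<open>The definition of \<open>P3m1_gr\<close> leaves the exponent of \<open>D123\<close>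
  open; fixing it at 3 places its generators in levels according to their C-degree.\<close>

lemma D123_power_Cmon_in_P3m1:
  assumes "D123 ^ d * Cmon m \<in> P3m1"
  shows "d = 3"
proof -
  \<comment> \<open>A homothety with factor \<open>2\<close> scales \<open>D123\<close> by \<open>1/4\<close> and fixes each \<open>C i j\<close>.\<close>
  define T :: "real^3^3" where "T = vector [vector [2, 0, 0], vector [0, 2, 0], vector [0, 0, 1]]"
  define z :: "var \<Rightarrow> real" where "z = slice (\<lambda>(i, j). if i = j then 0 else 1)"
  have det: "det T = 4" by (simp add: det_3 T_def)
  then have T: "invertible T" by (simp add: invertible_det_nz)
  have s: "sfac T z i = 1" for i
    by (simp add: sfac_def T_def matrix_vector_mult_def sum_3 pt_def)
  then have d: "act_defined T z" by (simp add: act_defined_def)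
  have C: "eval_poly (C i j) z = (if i = j then 0 else 1)" for i j
    unfolding z_def by (subst C_slice) auto
  \<comment> \<open>All off-diagonal \<open>C i j\<close> equal 1 at \<open>z\<close>, so each of
    the two 3-cycles contributes 1.\<close>
  have "eval_poly detA z * eval_poly D123 z = 2"
    using arg_cong[OF D123_mult_detA, of "\<lambda>F. eval_poly F z"] by (simp add: C mult.commute)
  then have D: "eval_poly D123 z \<noteq> 0" by auto
  have D_act: "eval_poly D123 (act T z) = eval_poly D123 z / 4"
    using D123_act[OF T d] by (simp add: det s)
  have Cmon: "eval_poly (Cmon m) (act T z) = 1" "eval_poly (Cmon m) z = 1"
    by (simp_all add: eval_poly_Cmon Cchar_def prod_offdiag C C_act[OF T d] s)
  have "det T ^ 3 * eval_poly (D123 ^ d * Cmon m) (act T z)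
      = (\<Prod>i\<in>UNIV. sfac T z i) ^ 3 * eval_poly (D123 ^ d * Cmon m) z"
    using assms T d unfolding P3m1_eq_rel_inv rel_inv_def by blast
  then have "4 ^ 3 * (eval_poly D123 z / 4) ^ d = eval_poly D123 z ^ d"
    by (simp add: det s D_act Cmon)
  then have "(4::real) ^ 3 = 4 ^ d" using D by (simp add: power_divide field_simps)
  then show ?thesis using power_inject_exp[of "4::real" 3 d] by simp
qed

lemma P3m1_gr_pos:
  assumes "k \<noteq> 0"
  shows "P3m1_gr k \<subseteq> P3m1_level 0"
  unfolding P3m1_gr_def
proof (rule rpoly.span_minimal)
  show "rpoly.subspace (P3m1_level 0)"
    using P3m1_level_add[of _ 0 _ 0] P3m1_level_scale[of _ 0]
    by (intro rpoly.subspaceI) (simp_all add: zero_in_P3m1_level)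
  show "{D123 ^ d * Cmon m | d m. D123 ^ d * Cmon m \<in> P3m1 \<and> Cdeg m = k} \<subseteq> P3m1_level 0"
  proof safe
    fix d m assume m: "D123 ^ d * Cmon m \<in> P3m1" "k = Cdeg m"
    have d: "d = 3" using D123_power_Cmon_in_P3m1 m(1) .
    then obtain r where "D123 ^ 3 * Cmon m \<in> P3m1_level r"
      using m(1) P3m1_eq_Union_levels by blast
    then show "D123 ^ d * Cmon m \<in> P3m1_level 0"
      using m(2) assms by (auto simp: d D123_cube_mult_in_level_iff eval_poly_Cmon_0)
  qed
qed

lemma Q3_gr_pos:
  assumes "k \<noteq> 0"
  shows "Q3_gr k = {\<zero>\<^bsub>Q3\<^esub>}"
proof -
  have "Q3_gr k = (\<lambda>F. P3m1_level 0) ` P3m1_gr k"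
    unfolding Q3_gr_def using P3m1_gr_pos[OF assms] coset_eq_level[of _ 0] by (intro image_cong) auto
  \<comment> \<open>The image is nonempty even if no monomial of degree \<open>k\<close> qualifies,
    so it is the zero space and not the empty set.\<close>
  moreover have "0 \<in> P3m1_gr k" unfolding P3m1_gr_def by (rule rpoly.span_zero)
  ultimately show ?thesis by (auto simp: zero_Q3)
qed

lemma Q3_gr_0: "Q3_gr 0 = carrier Q3"
proof
  have "rpoly.subspace P3m1"
    by (rule rpoly.subspaceI) (simp_all add: P3m1_def algebra_simps)
  then have "P3m1_gr 0 \<subseteq> P3m1"
    unfolding P3m1_gr_def by (intro rpoly.span_minimal) auto
  then show "Q3_gr 0 \<subseteq> carrier Q3"
    unfolding Q3_gr_def carrier_Q3 P3m1_eq_Union_levels using coset_eq_level by blast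
  show "carrier Q3 \<subseteq> Q3_gr 0"
    unfolding carrier_Q3
  proof safe
    fix r
    have "D123 ^ 3 * Cmon (\<lambda>_. 0) \<in> P3m1"
      using D123_power_rel_inv[of 3] by (simp add: Cmon_0 P3m1_eq_rel_inv)
    then have "D123 ^ 3 * Cmon (\<lambda>_. 0) \<in> P3m1_gr 0"
      unfolding P3m1_gr_def by (intro rpoly.span_base) (auto simp: Cdeg_def)
    then have "Const r * (D123 ^ 3 * Cmon (\<lambda>_. 0)) \<in> P3m1_gr 0"
      unfolding P3m1_gr_def by (rule rpoly.span_scale)
    then have "D123 ^ 3 * Const r \<in> P3m1_gr 0" by (simp add: Cmon_0 mult.commute)
    then show "P3m1_level r \<in> Q3_gr 0"
      unfolding Q3_gr_def using coset_eq_level[OF P3m1_level_nonempty[of r]] by blast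
  qed
qed

theorem mainTheorem11:
  shows "P3m1 = (\<lambda>F. D123 ^ 3 * F) ` A3 \<and>
    free_module_of_rank A3_ring P3m1_module 1 \<and>
    has_dimension real_ring Q3 1 \<and>
    Q3_gr 0 = carrier Q3 \<and>
    (\<forall>k. k \<noteq> 0 \<longrightarrow> Q3_gr k = {\<zero>\<^bsub>Q3\<^esub>})"
  using P3m1_eq P3m1_free Q3_dimension Q3_gr_0 Q3_gr_pos by blast

end
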